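(* Let $f$ be a $C^3$ random stationary centered Gaussian field on $\mathbb R^2$, with covariance $\mathbf E(f(x)f(y))=K(x-y)$, $K(0)=1$, satisfying the non-degeneracy condition for $m=3$: for every $k\in\{0,\dots,3\}$ the mapping $$(v_1,\dots,v_k)\in(\mathbb R^2)^k\mapsto d^{2k}K(0)(v_1,v_1,\dots,v_k,v_k)$$ is non-degenerate. Let $\mathcal T$ be a periodic lattice in $\mathbb R^2$ and $\mathcal E$ its set of edges. Fix $\delta>0$ and $\eta>0$. Then there exists $s(\delta,\eta)>0$ such that for every $s\ge s(\delta,\eta)$ and every $0<\varepsilon\le s^{-8-\eta}$, with probability at least $1-\delta$ the following event happens: $$\text{for every edge } e\in\varepsilon\mathcal E\cap[-s,s]^2,\qquad \#\big(e\cap f^{-1}(\{0\})\big)\le 1.$$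
   Context: The mapping $(v_1,\dots,v_k)\mapsto d^{2k}K(0)(v_1,v_1,\dots,v_k,v_k)$ is called non-degenerate if it takes a non-zero value whenever all of $v_1,\dots,v_k$ are non-zero (for $k=0$: $K(0)\neq 0$). Stationary fields are normalized so that $K(0)=1$. A periodic lattice $\mathcal T$ is a locally finite planar graph embedded in $\mathbb R^2$ with straight segments as edges, invariant under a group of translations generated by two linearly independent vectors. For $\varepsilon>0$, $\varepsilon\mathcal E$ is the set of edges of the rescaled lattice $\varepsilon\mathcal T$, and $e\in\varepsilon\mathcal E\cap[-s,s]^2$ means that $e$ is an edge of $\varepsilon\mathcal T$ contained in $[-s,s]^2$. *)

theory Defs
  imports "HOL-Probability.Probability"
begin

section \<open>Differentials of functions on a Euclidean space\<close>

text \<open>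
  \<open>higher_diff [w\<^sub>1, \<dots>, w\<^sub>j] g x\<close> is $d^j g(x)(w_1, \dots, w_j)$. As the type of the
  multilinear map $d^j g(x)$ depends on $j$, it is given through its values on vectors:
  $d^{j+1} g(x)(w_0, w_1, \dots, w_j)$ is the Frechet derivative at $x$ of
  $y \mapsto d^j g(y)(w_1, \dots, w_j)$, applied to $w_0$. The value is meaningful when $g$ is
  $j$ times differentiable.
\<close>

fun higher_diff :: "'a list \<Rightarrow> ('a::euclidean_space \<Rightarrow> real) \<Rightarrow> 'a \<Rightarrow> real" where
  "higher_diff [] g x = g x"
| "higher_diff (w # ws) g x = frechet_derivative (higher_diff ws g) (at x) w"

text \<open>
  Being of class $C^k$ on the whole space. In finite dimension, continuity (differentiability) of
  \<open>x \<mapsto> dg(x)\<close> is the same as that of \<open>x \<mapsto> dg(x)(v)\<close> for every fixed \<open>v\<close>.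
\<close>

fun class_C :: "nat \<Rightarrow> ('a::euclidean_space \<Rightarrow> real) \<Rightarrow> bool" where
  "class_C 0 g \<longleftrightarrow> continuous_on UNIV g"
| "class_C (Suc k) g \<longleftrightarrow>
     (\<forall>x. g differentiable (at x)) \<and> (\<forall>v. class_C k (\<lambda>x. frechet_derivative g (at x) v))"

text \<open>Non-degeneracy of $(v_1, \dots, v_k) \mapsto d^{2k} K(0)(v_1, v_1, \dots, v_k, v_k)$.\<close>

definition nondegenerate_at_order :: "nat \<Rightarrow> ('a::euclidean_space \<Rightarrow> real) \<Rightarrow> bool" where
  "nondegenerate_at_order k K \<longleftrightarrow>
     (\<forall>vs. length vs = k \<and> (\<forall>v\<in>set vs. v \<noteq> 0) \<longrightarrow>
        higher_diff (concat (map (\<lambda>v. [v, v]) vs)) K 0 \<noteq> 0)"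

section \<open>Gaussian fields\<close>

text \<open>The second alternative is the degenerate normal law of variance 0.\<close>

definition gaussian_variable :: "'w measure \<Rightarrow> ('w \<Rightarrow> real) \<Rightarrow> bool" where
  "gaussian_variable M X \<longleftrightarrow> X \<in> borel_measurable M \<and>
     ((\<exists>\<mu> \<sigma>. \<sigma> > 0 \<and> distributed M lborel X (normal_density \<mu> \<sigma>)) \<or>
      (\<exists>\<mu>. AE \<omega> in M. X \<omega> = \<mu>))"

definition gaussian_field :: "'w measure \<Rightarrow> ('w \<Rightarrow> 'a \<Rightarrow> real) \<Rightarrow> bool" where
  "gaussian_field M f \<longleftrightarrow>
     (\<forall>J c. finite J \<longrightarrow> gaussian_variable M (\<lambda>\<omega>. \<Sum>x\<in>J. c x * f \<omega> x))"

definition centered_field :: "'w measure \<Rightarrow> ('w \<Rightarrow> 'a \<Rightarrow> real) \<Rightarrow> bool" where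
  "centered_field M f \<longleftrightarrow> (\<forall>x. (\<integral>\<omega>. f \<omega> x \<partial>M) = 0)"

definition stationary_field :: "'w measure \<Rightarrow> ('w \<Rightarrow> 'a::real_vector \<Rightarrow> real) \<Rightarrow> bool" where
  "stationary_field M f \<longleftrightarrow>
     (\<forall>J h. finite J \<longrightarrow>
        distr M (\<Pi>\<^sub>M x\<in>J. borel) (\<lambda>\<omega>. \<lambda>x\<in>J. f \<omega> (x + h)) =
        distr M (\<Pi>\<^sub>M x\<in>J. borel) (\<lambda>\<omega>. \<lambda>x\<in>J. f \<omega> x))"

definition has_covariance ::
    "'w measure \<Rightarrow> ('w \<Rightarrow> 'a::real_vector \<Rightarrow> real) \<Rightarrow> ('a \<Rightarrow> real) \<Rightarrow> bool" where
  "has_covariance M f K \<longleftrightarrow> (\<forall>x y. (\<integral>\<omega>. f \<omega> x * f \<omega> y \<partial>M) = K (x - y))"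

section \<open>Periodic lattices\<close>

text \<open>
  An edge is represented by the closed segment that it occupies in the plane. The conditions
  \<open>e \<inter> V = {a, b}\<close> and \<open>e \<inter> e' \<subseteq> V\<close> say together that the drawing is planar: edges run through
  no vertex but their endpoints, and distinct edges meet at common endpoints only.
\<close>

definition planar_straight_graph :: "(real^2) set \<Rightarrow> (real^2) set set \<Rightarrow> bool" where
  "planar_straight_graph V E \<longleftrightarrow>
     (\<forall>e\<in>E. \<exists>a\<in>V. \<exists>b\<in>V. a \<noteq> b \<and> e = closed_segment a b \<and> e \<inter> V = {a, b}) \<and>
     (\<forall>e\<in>E. \<forall>e'\<in>E. e \<noteq> e' \<longrightarrow> e \<inter> e' \<subseteq> V)"

text \<open>Local finiteness is meant for the embedded graph, not only for the vertex degrees.\<close>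

definition locally_finite_graph :: "(real^2) set \<Rightarrow> (real^2) set set \<Rightarrow> bool" where
  "locally_finite_graph V E \<longleftrightarrow>
     (\<forall>B. bounded B \<longrightarrow> finite (V \<inter> B) \<and> finite {e \<in> E. e \<inter> B \<noteq> {}})"

definition periodic_lattice :: "(real^2) set \<Rightarrow> (real^2) set set \<Rightarrow> bool" where
  "periodic_lattice V E \<longleftrightarrow>
     planar_straight_graph V E \<and> locally_finite_graph V E \<and>
     (\<exists>u w. u \<noteq> w \<and> independent {u, w} \<and>
        (\<forall>m n :: int. let t = of_int m *\<^sub>R u + of_int n *\<^sub>R w in
           (+) t ` V = V \<and> (\<lambda>e. (+) t ` e) ` E = E))"

definition scaled_edges :: "real \<Rightarrow> (real^2) set set \<Rightarrow> (real^2) set set" where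
  "scaled_edges \<epsilon> E = (\<lambda>e. (*\<^sub>R) \<epsilon> ` e) ` E"

definition square :: "real \<Rightarrow> (real^2) set" where
  "square s = {x. \<forall>i. x $ i \<in> {-s..s}}"

text \<open>Finiteness is required explicitly because the cardinality of an infinite set is 0.\<close>

definition crosses_edges_at_most_once ::
    "(real^2 \<Rightarrow> real) \<Rightarrow> (real^2) set set \<Rightarrow> real \<Rightarrow> bool" where
  "crosses_edges_at_most_once g E s \<longleftrightarrow>
     (\<forall>e\<in>E. e \<subseteq> square s \<longrightarrow> finite (e \<inter> g -` {0}) \<and> card (e \<inter> g -` {0}) \<le> 1)"

end

theory Submission
  imports Defs
begin

text \<open>
  If \<open>f\<close> has two zeros on a segment of length of order \<open>\<epsilon>\<close> starting at \<open>x\<close> then its derivative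
  along the segment vanishes somewhere on it, so \<open>f(x)\<close> and the slope of \<open>f\<close> at \<open>x\<close> are at most of
  order \<open>\<epsilon>\<^sup>2 u\<close> and \<open>\<epsilon> u\<close>, where \<open>u\<close> is the mean of \<open>|f''|\<close> over the segment. Value and slope
  are jointly Gaussian and non-degenerate, so this has probability \<open>O(\<epsilon>\<^sup>3 u\<^sup>2)\<close>, while \<open>u\<close> has
  moments of all orders. With \<open>\<epsilon> = q\<^sup>4\<close> and \<open>u = 1/q\<close>, using the 12th moment of the mean of \<open>|f''|\<close>,
  a segment is bad with probability \<open>O(q\<^sup>1\<^sup>0)\<close>. There are \<open>O(s\<^sup>2/q\<^sup>8)\<close> edges, and \<open>s\<^sup>2 q\<^sup>2 \<le> s\<^sup>-\<^sup>2\<close>.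

  Derivatives of the field are replaced by difference quotients throughout: these are finite linear
  combinations of values of the field, hence Gaussian, and Gaussian variables tending to 0 almost
  surely tend to 0 in \<open>L\<^sup>2\<close>. This gives the bound on the variances of second differences, the
  differentiability of \<open>K\<close> and, because \<open>K\<close> would otherwise be constant along a direction, a lower
  bound on the variances of slopes.
\<close>

section \<open>Centered normal variables\<close>

text \<open>The exponents come from a balance. Against about s^2 / \<epsilon>^2 edges, a probability
  \<epsilon>^3 u^2 per segment leaves s^2 \<epsilon> u^2. So u must stay well below
  \<epsilon>^(-1/2), yet grow like a negative power of \<epsilon> for a moment bound on the second
  derivative to beat the number of edges. The choice u = \<epsilon>^(-1/4) leaves s^2
  \<epsilon>^(1/2), and this is at most s^(-2) exactly when \<epsilon> <= s^(-8). The obstacle is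
  that the hypotheses control only finite linear combinations of values, and smoothness of paths
  only almost surely: measurability, normality and moments of derivatives are not given. This is
  also why the mean of the second derivative replaces its supremum: by convexity the moments of a
  mean are bounded by those of its terms, while a supremum would require a maximal inequality. Two
  costs remain. The mesh at which differences detect a double zero depends on the sample, so bad
  events are bounded through a lower limit of grid events. And the final event is determined by
  countably many values only off a null set, so it is measurable only in the completion.\<close>

definition (in prob_space) centered_normal :: "('a \<Rightarrow> real) \<Rightarrow> bool" where
  "centered_normal X \<longleftrightarrow> X \<in> borel_measurable M \<and>
     (\<exists>\<sigma>\<ge>0. distr M borel X = distr std_normal_distribution borel (\<lambda>z. \<sigma> * z))"

lemma prob_space_std_normal_distribution: "prob_space std_normal_distribution"
  using prob_space_normal_density by auto

lemma (in prob_space) gaussian_variable_integrable: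
  assumes "gaussian_variable M X"
  shows "integrable M X"
  using assms unfolding gaussian_variable_def
proof (elim conjE disjE exE)
  fix \<mu> \<sigma> :: real
  assume X: "\<sigma> > 0" "distributed M lborel X (normal_density \<mu> \<sigma>)"
  have "integrable lborel (\<lambda>x. normal_density \<mu> \<sigma> x * x)"
    using integrable_normal_moment_nz_1[OF X(1)] by simp
  then show ?thesis
    using distributed_integrable[OF X(2), of "\<lambda>x. x"] by simp
next
  fix \<mu> :: real
  assume "X \<in> borel_measurable M" and "AE \<omega> in M. X \<omega> = \<mu>"
  then show ?thesis
    by (subst integrable_cong_AE[of _ _ "\<lambda>_. \<mu>"]) auto
qed

text \<open>The degenerate alternative of \<open>gaussian_variable\<close> becomes the scaling
  \<sigma> = 0 of the standard normal law. Moments and characteristic functions can then be computed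
  without separating the two cases, which matters because difference quotients may have variance
  0.\<close>

lemma (in prob_space) gaussian_variable_centered:
  assumes "gaussian_variable M X" and "expectation X = 0"
  shows "centered_normal X"
proof -
  have [measurable]: "X \<in> borel_measurable M"
    using assms(1) by (simp add: gaussian_variable_def)
  have "\<exists>\<sigma>\<ge>0. distr M borel X = distr std_normal_distribution borel (\<lambda>z. \<sigma> * z)"
    using assms(1) unfolding gaussian_variable_def
  proof (elim conjE disjE exE)
    fix \<mu> \<sigma> :: real
    assume X: "\<sigma> > 0" "distributed M lborel X (normal_density \<mu> \<sigma>)"
    have "\<mu> = 0"
      using normal_distributed_expectation[OF X] assms(2) by simp
    with X have "distributed M lborel (\<lambda>x. X x / \<sigma>) std_normal_density"
      using normal_standard_normal_convert[OF X(1), of X 0] by simp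
    then have "distr M lborel (\<lambda>x. X x / \<sigma>) = std_normal_distribution"
      by (simp add: distributed_def)
    then have "distr std_normal_distribution borel (\<lambda>z. \<sigma> * z) =
        distr (distr M lborel (\<lambda>x. X x / \<sigma>)) borel (\<lambda>z. \<sigma> * z)"
      by simp
    also have "\<dots> = distr M borel X"
      using X(1) by (subst distr_distr) (auto simp: o_def)
    finally show ?thesis
      using X(1) by (metis less_imp_le)
  next
    fix \<mu> :: real
    assume ae: "AE \<omega> in M. X \<omega> = \<mu>"
    then have "expectation X = \<mu>"
      by (subst integral_cong_AE[of _ _ "\<lambda>_. \<mu>"]) (auto simp: prob_space)
    with ae assms(2) have ae: "AE \<omega> in M. X \<omega> = 0" by simp
    interpret N: prob_space std_normal_distribution
      by (rule prob_space_std_normal_distribution)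
    have "distr M borel X = distr M borel (\<lambda>_. 0)"
      using ae by (intro distr_cong_AE) auto
    also have "\<dots> = distr std_normal_distribution borel (\<lambda>z. 0 * z)"
      by (simp add: distr_const N.distr_const)
    finally show ?thesis by blast
  qed
  then show ?thesis by (simp add: centered_normal_def)
qed

text \<open>Everything is pulled back to the standard normal law. The scale \<sigma> is eliminated
  in favour of the variance, since variances are what the covariance \<open>K\<close> gives access
  to.\<close>

lemma (in prob_space) centered_normal_moments:
  assumes "centered_normal X"
  shows "integrable M (\<lambda>\<omega>. X \<omega> ^ (2 * k))"
    and "expectation (\<lambda>\<omega>. X \<omega> ^ (2 * k)) =
      fact (2 * k) / (2 ^ k * fact k) * expectation (\<lambda>\<omega>. (X \<omega>)\<^sup>2) ^ k"
    and "(CLINT \<omega>|M. iexp (u * X \<omega>)) = exp (- (u\<^sup>2 * expectation (\<lambda>\<omega>. (X \<omega>)\<^sup>2)) / 2)"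
proof -
  have [measurable]: "X \<in> borel_measurable M"
    using assms by (simp add: centered_normal_def)
  obtain \<sigma> where "\<sigma> \<ge> 0"
    and \<sigma>: "distr M borel X = distr std_normal_distribution borel (\<lambda>z. \<sigma> * z)"
    using assms by (auto simp: centered_normal_def)
  \<comment> \<open>Polymorphic in the codomain, to serve both the real powers and the complex
    exponential.\<close>
  have transfer: "integrable M (\<lambda>\<omega>. g (X \<omega>)) \<longleftrightarrow> integrable std_normal_distribution (\<lambda>z. g (\<sigma> * z))"
    "(\<integral>\<omega>. g (X \<omega>) \<partial>M) = (\<integral>z. g (\<sigma> * z) \<partial>std_normal_distribution)"
    if [measurable]: "g \<in> borel_measurable borel"
    for g :: "real \<Rightarrow> 'c::{banach, second_countable_topology}"
  proof -
    have "integrable M (\<lambda>\<omega>. g (X \<omega>)) \<longleftrightarrow> integrable (distr M borel X) g"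
      by (simp add: integrable_distr_eq)
    then show "integrable M (\<lambda>\<omega>. g (X \<omega>)) \<longleftrightarrow>
        integrable std_normal_distribution (\<lambda>z. g (\<sigma> * z))"
      unfolding \<sigma> by (simp add: integrable_distr_eq)
    have "(\<integral>\<omega>. g (X \<omega>) \<partial>M) = integral\<^sup>L (distr M borel X) g"
      by (simp add: integral_distr)
    then show "(\<integral>\<omega>. g (X \<omega>) \<partial>M) = (\<integral>z. g (\<sigma> * z) \<partial>std_normal_distribution)"
      unfolding \<sigma> by (simp add: integral_distr)
  qed
  show "integrable M (\<lambda>\<omega>. X \<omega> ^ (2 * k))"
    using transfer(1)[of "\<lambda>x. x ^ (2 * k)"] std_normal_distribution_even_moments(2)[of k]
    by (simp add: power_mult_distrib)
  have moment: "expectation (\<lambda>\<omega>. X \<omega> ^ (2 * j)) = fact (2 * j) / (2 ^ j * fact j) * \<sigma> ^ (2 * j)" for j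
    using transfer(2)[of "\<lambda>x. x ^ (2 * j)"] std_normal_distribution_even_moments(1)[of j]
    by (simp add: power_mult_distrib)
  have var: "expectation (\<lambda>\<omega>. (X \<omega>)\<^sup>2) = \<sigma>\<^sup>2"
    using moment[of 1] by simp
  show "expectation (\<lambda>\<omega>. X \<omega> ^ (2 * k)) =
      fact (2 * k) / (2 ^ k * fact k) * expectation (\<lambda>\<omega>. (X \<omega>)\<^sup>2) ^ k"
    using moment[of k] by (simp add: var power_mult)
  have "(CLINT \<omega>|M. iexp (u * X \<omega>)) = char std_normal_distribution (u * \<sigma>)"
    by (subst transfer(2)[of "\<lambda>x. iexp (u * x)"]) (auto simp: char_def mult.assoc)
  then show "(CLINT \<omega>|M. iexp (u * X \<omega>)) = exp (- (u\<^sup>2 * expectation (\<lambda>\<omega>. (X \<omega>)\<^sup>2)) / 2)"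
    by (simp add: char_std_normal_distribution var power_mult_distrib exp_of_real [symmetric])
qed

lemma integral_exp_neg_square_real:
  assumes "b > 0"
  shows "integrable lborel (\<lambda>x. exp (- (b * x\<^sup>2)) :: real)"
    and "(\<integral>x. exp (- (b * x\<^sup>2)) \<partial>lborel) = sqrt (pi / b)"
proof -
  define s where "s = 1 / sqrt (2 * b)"
  have s: "s > 0" "2 * s\<^sup>2 = 1 / b"
    using assms by (auto simp: s_def power_divide)
  have eq: "exp (- (b * x\<^sup>2)) = sqrt (pi / b) * normal_density 0 s x" for x :: real
  proof -
    have "2 * pi * s\<^sup>2 = pi / b" using s(2) by (metis (no_types) mult.assoc mult.commute mult.right_neutral times_divide_eq_right)
    moreover have "x\<^sup>2 / (2 * s\<^sup>2) = b * x\<^sup>2" using s(2) by simp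
    ultimately show ?thesis
      using assms by (simp add: normal_density_def)
  qed
  show "integrable lborel (\<lambda>x. exp (- (b * x\<^sup>2)) :: real)"
    unfolding eq using s(1) by (intro integrable_mult_right) simp
  show "(\<integral>x. exp (- (b * x\<^sup>2)) \<partial>lborel) = sqrt (pi / b)"
    unfolding eq using s(1) by simp
qed

text \<open>The factor exp(-z^2/2) of the density is bounded by 1. The exact value is 1 / sqrt(1 +
  2b), so little is lost for large b, which is the case of small balls.\<close>

lemma integral_std_normal_exp_neg_square:
  assumes "b > 0"
  shows "integrable std_normal_distribution (\<lambda>z. exp (- (b * z\<^sup>2)) :: real)"
    and "(\<integral>z. exp (- (b * z\<^sup>2)) \<partial>std_normal_distribution) \<le> 1 / sqrt (2 * b)"
proof -
  interpret N: prob_space std_normal_distribution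
    by (rule prob_space_std_normal_distribution)
  show int: "integrable std_normal_distribution (\<lambda>z. exp (- (b * z\<^sup>2)) :: real)"
    using assms by (intro N.integrable_const_bound[of _ 1]) auto
  have "(\<integral>z. exp (- (b * z\<^sup>2)) \<partial>std_normal_distribution) =
      (\<integral>z. std_normal_density z * exp (- (b * z\<^sup>2)) \<partial>lborel)"
    by (subst integral_density) auto
  also have "\<dots> \<le> (\<integral>z. 1 / sqrt (2 * pi) * exp (- (b * z\<^sup>2)) \<partial>lborel)"
  proof (rule integral_mono)
    show "integrable lborel (\<lambda>z. std_normal_density z * exp (- (b * z\<^sup>2)))"
      using int by (subst (asm) integrable_density) auto
    show "integrable lborel (\<lambda>z. 1 / sqrt (2 * pi) * exp (- (b * z\<^sup>2)))"
      using integral_exp_neg_square_real(1)[OF assms] by simp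
    show "std_normal_density z * exp (- (b * z\<^sup>2)) \<le> 1 / sqrt (2 * pi) * exp (- (b * z\<^sup>2))" for z
      by (intro mult_right_mono) (auto simp: std_normal_density_def divide_le_cancel field_simps)
  qed
  also have "\<dots> = 1 / sqrt (2 * b)"
    using integral_exp_neg_square_real(2)[OF assms] assms
    by (simp add: real_sqrt_mult real_sqrt_divide field_simps)
  finally show "(\<integral>z. exp (- (b * z\<^sup>2)) \<partial>std_normal_distribution) \<le> 1 / sqrt (2 * b)" .
qed

text \<open>
  The Gaussian weight \<open>exp (- x\<^sup>2 / 2)\<close> is its own characteristic function, so the expectation of
  \<open>exp (- (X / \<alpha>)\<^sup>2 / 2 - (Y / \<beta>)\<^sup>2 / 2)\<close> is a Gaussian average of the joint characteristic
  function of \<open>X\<close> and \<open>Y\<close>. No joint density of \<open>X\<close> and \<open>Y\<close> is needed.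
\<close>

lemma (in prob_space) gaussian_small_ball:
  assumes [measurable]: "X \<in> borel_measurable M" "Y \<in> borel_measurable M"
    and char: "\<And>a b. (CLINT \<omega>|M. iexp (a * X \<omega> + b * Y \<omega>)) = complex_of_real (exp (- Q a b / 2))"
    and Q: "\<And>a b. p * a\<^sup>2 + c * b\<^sup>2 \<le> Q a b"
    and pos: "p > 0" "c > 0" "\<alpha> > 0" "\<beta> > 0"
  shows "prob {\<omega> \<in> space M. \<bar>X \<omega>\<bar> \<le> \<alpha> \<and> \<bar>Y \<omega>\<bar> \<le> \<beta>} \<le> exp 1 * \<alpha> * \<beta> / sqrt (p * c)"
proof -
  let ?N = std_normal_distribution
  let ?F = "\<lambda>\<omega> z. iexp (fst z / \<alpha> * X \<omega> + snd z / \<beta> * Y \<omega>)"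
  let ?G = "\<lambda>\<omega>. exp (- (X \<omega> / \<alpha>)\<^sup>2 / 2) * exp (- (Y \<omega> / \<beta>)\<^sup>2 / 2)"
  interpret N: prob_space ?N
    by (rule prob_space_std_normal_distribution)
  interpret NN: pair_prob_space ?N ?N ..
  interpret MNN: pair_prob_space M "?N \<Otimes>\<^sub>M ?N" ..
  have weight: "(CLINT z|?N. iexp (t * z)) = complex_of_real (exp (- t\<^sup>2 / 2))" for t
    using fun_cong[OF char_std_normal_distribution, of t] by (simp add: char_def)
  have inner: "(CLINT z|?N \<Otimes>\<^sub>M ?N. ?F \<omega> z) = complex_of_real (?G \<omega>)" for \<omega>
  proof -
    have "integrable (?N \<Otimes>\<^sub>M ?N) (?F \<omega>)"
      by (intro NN.P.integrable_const_bound[of _ 1]) auto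
    then have "(CLINT z|?N \<Otimes>\<^sub>M ?N. ?F \<omega> z) = (CLINT z1|?N. CLINT z2|?N. ?F \<omega> (z1, z2))"
      by (subst NN.integral_fst'[symmetric]) (assumption, simp only: fst_conv snd_conv)
    also have "\<dots> = (CLINT z1|?N. CLINT z2|?N. iexp (X \<omega> / \<alpha> * z1) * iexp (Y \<omega> / \<beta> * z2))"
      by (simp add: distrib_left exp_add mult_ac)
    also have "\<dots> = complex_of_real (?G \<omega>)"
      by (simp only: Bochner_Integration.integral_mult_right_zero
          Bochner_Integration.integral_mult_left_zero weight[unfolded of_real_mult] of_real_mult)
    finally show ?thesis .
  qed
  have "complex_of_real (expectation ?G) = (CLINT \<omega>|M. complex_of_real (?G \<omega>))"
    by (simp only: integral_complex_of_real)
  also have "\<dots> = (CLINT \<omega>|M. CLINT z|?N \<Otimes>\<^sub>M ?N. ?F \<omega> z)"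
    by (simp only: inner)
  also have "\<dots> = (CLINT z|?N \<Otimes>\<^sub>M ?N. CLINT \<omega>|M. ?F \<omega> z)"
    by (intro MNN.Fubini_integral[symmetric] MNN.P.integrable_const_bound[of _ 1])
      (auto simp: case_prod_unfold)
  also have "\<dots> = (CLINT z|?N \<Otimes>\<^sub>M ?N. complex_of_real (exp (- Q (fst z / \<alpha>) (snd z / \<beta>) / 2)))"
    by (simp only: char)
  finally have eq: "complex_of_real (expectation ?G) = \<dots>" .
  \<comment> \<open>Half of the lower bound for \<open>Q\<close>, evaluated at a = z1 / \<alpha> and
    b = z2 / \<beta>. The two variables separate, and each factor is a one-dimensional Gaussian
    integral.\<close>
  define b1 where "b1 = p / (2 * \<alpha>\<^sup>2)"
  define b2 where "b2 = c / (2 * \<beta>\<^sup>2)"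
  have b: "b1 > 0" "b2 > 0" using pos by (auto simp: b1_def b2_def)
  let ?H = "\<lambda>z. exp (- (b1 * (fst z)\<^sup>2)) * exp (- (b2 * (snd z)\<^sup>2))"
  have intH: "integrable (?N \<Otimes>\<^sub>M ?N) ?H"
    using b by (intro NN.P.integrable_const_bound[of _ 1]) (auto intro!: mult_le_one)
  have "expectation ?G = norm (CLINT z|?N \<Otimes>\<^sub>M ?N. complex_of_real (exp (- Q (fst z / \<alpha>) (snd z / \<beta>) / 2)))"
    unfolding eq[symmetric] by (simp only: norm_of_real) (intro abs_of_nonneg[symmetric] integral_nonneg_AE, simp)
  also have "\<dots> \<le> (\<integral>z. ?H z \<partial>(?N \<Otimes>\<^sub>M ?N))"
  proof (rule order_trans[OF integral_norm_bound], rule integral_mono')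
    show "norm (complex_of_real (exp (- Q (fst z / \<alpha>) (snd z / \<beta>) / 2))) \<le> ?H z" for z :: "real \<times> real"
      using Q[of "fst z / \<alpha>" "snd z / \<beta>"]
      by (simp add: b1_def b2_def power_divide exp_add[symmetric] field_simps)
  qed (use intH in auto)
  also have "\<dots> = (\<integral>x. exp (- (b1 * x\<^sup>2)) \<partial>?N) * (\<integral>y. exp (- (b2 * y\<^sup>2)) \<partial>?N)"
    using intH by (subst NN.integral_fst'[symmetric]) auto
  also have "\<dots> \<le> 1 / sqrt (2 * b1) * (1 / sqrt (2 * b2))"
    using b by (intro mult_mono integral_std_normal_exp_neg_square integral_nonneg_AE) auto
  also have "\<dots> = \<alpha> * \<beta> / sqrt (p * c)"
    using pos by (simp add: b1_def b2_def real_sqrt_divide real_sqrt_mult)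
  finally have bound: "expectation ?G \<le> \<alpha> * \<beta> / sqrt (p * c)" .
  have intG: "integrable M ?G"
    by (intro integrable_const_bound[of _ 1]) (auto intro!: mult_le_one)
  \<comment> \<open>On the small ball each exponent is at least -1/2, so the weight is at least
    exp(-1); Markov's inequality costs the factor exp 1.\<close>
  have "prob {\<omega> \<in> space M. \<bar>X \<omega>\<bar> \<le> \<alpha> \<and> \<bar>Y \<omega>\<bar> \<le> \<beta>} \<le> prob {\<omega> \<in> space M. ?G \<omega> \<ge> exp (- 1)}"
  proof (rule finite_measure_mono)
    show "{\<omega> \<in> space M. \<bar>X \<omega>\<bar> \<le> \<alpha> \<and> \<bar>Y \<omega>\<bar> \<le> \<beta>} \<subseteq> {\<omega> \<in> space M. ?G \<omega> \<ge> exp (- 1)}"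
    proof safe
      fix \<omega> assume "\<bar>X \<omega>\<bar> \<le> \<alpha>" "\<bar>Y \<omega>\<bar> \<le> \<beta>"
      then have "(X \<omega> / \<alpha>)\<^sup>2 \<le> 1" "(Y \<omega> / \<beta>)\<^sup>2 \<le> 1"
        using pos by (auto simp: abs_square_le_1)
      then show "?G \<omega> \<ge> exp (- 1)"
        by (simp add: exp_add[symmetric])
    qed
  qed measurable
  also have "\<dots> \<le> expectation ?G / exp (- 1)"
    by (intro integral_Markov_inequality_measure[OF intG, of "{}"]) auto
  also have "\<dots> \<le> \<alpha> * \<beta> / sqrt (p * c) / exp (- 1)"
    using bound by (intro divide_right_mono) auto
  also have "\<dots> = exp 1 * \<alpha> * \<beta> / sqrt (p * c)"
    by (simp add: exp_minus field_simps)
  finally show ?thesis .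
qed

section \<open>Linear combinations of values of a Gaussian field\<close>

locale centered_gaussian_field = prob_space M for M :: "'w measure" +
  fixes f :: "'w \<Rightarrow> 'a::euclidean_space \<Rightarrow> real" and K :: "'a \<Rightarrow> real"
  assumes gaussian: "gaussian_field M f"
    and centered: "centered_field M f"
    and covariance: "has_covariance M f K"
begin

text \<open>These are exactly the variables about which \<open>gaussian_field\<close> speaks. With
  the closure rules collected in \<open>lincombs_intros\<close>, normality of any difference
  quotient is checked by following its syntax.\<close>

definition lincombs :: "('w \<Rightarrow> real) set" where
  "lincombs = {Z. \<exists>J c. finite J \<and> Z = (\<lambda>\<omega>. \<Sum>x\<in>J. c x * f \<omega> x)}"

lemma lincombs_value: "(\<lambda>\<omega>. f \<omega> x) \<in> lincombs"
  by (auto simp: lincombs_def intro!: exI[of _ "{x}"] exI[of _ "\<lambda>_. 1"])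

lemma lincombs_add:
  assumes "X \<in> lincombs" "Y \<in> lincombs"
  shows "(\<lambda>\<omega>. X \<omega> + Y \<omega>) \<in> lincombs"
proof -
  obtain I c J d where fin: "finite I" "finite J"
    and X: "X = (\<lambda>\<omega>. \<Sum>x\<in>I. c x * f \<omega> x)" and Y: "Y = (\<lambda>\<omega>. \<Sum>x\<in>J. d x * f \<omega> x)"
    using assms by (auto simp: lincombs_def)
  let ?c = "\<lambda>x. (if x \<in> I then c x else 0) + (if x \<in> J then d x else 0)"
  have "X \<omega> + Y \<omega> = (\<Sum>x\<in>I \<union> J. ?c x * f \<omega> x)" for \<omega>
  proof -
    have "X \<omega> = (\<Sum>x\<in>I \<union> J. (if x \<in> I then c x else 0) * f \<omega> x)"
      unfolding X using fin by (intro sum.mono_neutral_cong_left) auto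
    moreover have "Y \<omega> = (\<Sum>x\<in>I \<union> J. (if x \<in> J then d x else 0) * f \<omega> x)"
      unfolding Y using fin by (intro sum.mono_neutral_cong_left) auto
    ultimately show ?thesis
      by (simp add: distrib_right sum.distrib)
  qed
  then show ?thesis
    unfolding lincombs_def using fin by (intro CollectI exI[of _ "I \<union> J"] exI[of _ ?c]) auto
qed

lemma lincombs_scale:
  assumes "X \<in> lincombs"
  shows "(\<lambda>\<omega>. r * X \<omega>) \<in> lincombs"
proof -
  obtain I c where "finite I" and X: "X = (\<lambda>\<omega>. \<Sum>x\<in>I. c x * f \<omega> x)"
    using assms by (auto simp: lincombs_def)
  then show ?thesis
    unfolding lincombs_def
    by (intro CollectI exI[of _ I] exI[of _ "\<lambda>x. r * c x"]) (auto simp: sum_distrib_left mult.assoc)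
qed

lemma lincombs_divide: "X \<in> lincombs \<Longrightarrow> (\<lambda>\<omega>. X \<omega> / r) \<in> lincombs"
  using lincombs_scale[of X "1 / r"] by simp

lemma lincombs_diff:
  assumes "X \<in> lincombs" "Y \<in> lincombs"
  shows "(\<lambda>\<omega>. X \<omega> - Y \<omega>) \<in> lincombs"
  using lincombs_add[OF assms(1) lincombs_scale[OF assms(2), of "-1"]] by simp

lemma lincombs_sum:
  assumes "finite S" "\<And>i. i \<in> S \<Longrightarrow> X i \<in> lincombs"
  shows "(\<lambda>\<omega>. \<Sum>i\<in>S. X i \<omega>) \<in> lincombs"
  using assms
proof (induction S)
  case empty
  show ?case by (auto simp: lincombs_def intro!: exI[of _ "{}"])
next
  case (insert i S)
  then show ?case using lincombs_add[of "X i" "\<lambda>\<omega>. \<Sum>i\<in>S. X i \<omega>"] by simp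
qed

lemmas lincombs_intros =
  lincombs_value lincombs_add lincombs_diff lincombs_scale lincombs_divide lincombs_sum

lemma gaussian_value: "gaussian_variable M (\<lambda>\<omega>. f \<omega> x)"
  using gaussian[unfolded gaussian_field_def, rule_format, of "{x}" "\<lambda>_. 1"] by simp

lemma measurable_value [measurable]: "(\<lambda>\<omega>. f \<omega> x) \<in> borel_measurable M"
  using gaussian_value by (simp add: gaussian_variable_def)

lemma lincombs_centered_normal:
  assumes "Z \<in> lincombs"
  shows "centered_normal Z"
proof -
  obtain J c where J: "finite J" and Z: "Z = (\<lambda>\<omega>. \<Sum>x\<in>J. c x * f \<omega> x)"
    using assms by (auto simp: lincombs_def)
  have "expectation Z = 0"
    using centered unfolding Z centered_field_def
    by (subst Bochner_Integration.integral_sum)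
      (auto intro: gaussian_variable_integrable gaussian_value)
  moreover have "gaussian_variable M Z"
    unfolding Z using gaussian J unfolding gaussian_field_def by blast
  ultimately show ?thesis
    by (intro gaussian_variable_centered)
qed

lemma lincombs_measurable: "Z \<in> lincombs \<Longrightarrow> Z \<in> borel_measurable M"
  using lincombs_centered_normal by (auto simp: centered_normal_def)

lemma lincombs_integrable_square:
  assumes "Z \<in> lincombs"
  shows "integrable M (\<lambda>\<omega>. (Z \<omega>)\<^sup>2)"
  using centered_normal_moments(1)[OF lincombs_centered_normal[OF assms], of 1] by simp

lemma lincombs_integrable_mult:
  assumes "Y \<in> lincombs" "Z \<in> lincombs"
  shows "integrable M (\<lambda>\<omega>. Y \<omega> * Z \<omega>)"
proof (rule Bochner_Integration.integrable_bound)
  show "integrable M (\<lambda>\<omega>. (Y \<omega>)\<^sup>2 + (Z \<omega>)\<^sup>2)"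
    using assms by (intro Bochner_Integration.integrable_add lincombs_integrable_square)
  show "(\<lambda>\<omega>. Y \<omega> * Z \<omega>) \<in> borel_measurable M"
    using assms by (intro borel_measurable_times lincombs_measurable)
  have "\<bar>y * z\<bar> \<le> y\<^sup>2 + z\<^sup>2" for y z :: real
  proof -
    have "2 * (\<bar>y\<bar> * \<bar>z\<bar>) \<le> y\<^sup>2 + z\<^sup>2"
      using sum_squares_bound[of "\<bar>y\<bar>" "\<bar>z\<bar>"] by simp
    moreover have "0 \<le> \<bar>y\<bar> * \<bar>z\<bar>" by simp
    ultimately show ?thesis unfolding abs_mult by linarith
  qed
  then show "AE \<omega> in M. norm (Y \<omega> * Z \<omega>) \<le> norm ((Y \<omega>)\<^sup>2 + (Z \<omega>)\<^sup>2)"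
    by (auto intro!: AE_I2 simp: abs_of_nonneg)
qed

lemma expectation_value_mult: "expectation (\<lambda>\<omega>. f \<omega> x * f \<omega> y) = K (x - y)"
  using covariance by (simp add: has_covariance_def)

lemma covariance_minus: "K (- h) = K h"
  using expectation_value_mult[of 0 h] expectation_value_mult[of h 0] by (simp add: mult.commute)

text \<open>Indices are kept apart from the points \<open>p i\<close>, so points that coincide, as
  for an increment with h = 0, are no special case.\<close>

lemma expectation_lincomb_square:
  assumes "finite J"
  shows "expectation (\<lambda>\<omega>. (\<Sum>i\<in>J. c i * f \<omega> (p i))\<^sup>2) = (\<Sum>i\<in>J. \<Sum>j\<in>J. c i * c j * K (p i - p j))"
proof -
  have int: "integrable M (\<lambda>\<omega>. c i * f \<omega> (p i) * (c j * f \<omega> (p j)))" for i j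
    by (intro lincombs_integrable_mult lincombs_intros)
  have "expectation (\<lambda>\<omega>. (\<Sum>i\<in>J. c i * f \<omega> (p i))\<^sup>2) =
      expectation (\<lambda>\<omega>. \<Sum>i\<in>J. \<Sum>j\<in>J. c i * f \<omega> (p i) * (c j * f \<omega> (p j)))"
    by (simp add: power2_eq_square sum_product)
  also have "\<dots> = (\<Sum>i\<in>J. \<Sum>j\<in>J. expectation (\<lambda>\<omega>. c i * f \<omega> (p i) * (c j * f \<omega> (p j))))"
    by (simp add: int)
  also have "\<dots> = (\<Sum>i\<in>J. \<Sum>j\<in>J. expectation (\<lambda>\<omega>. c i * c j * (f \<omega> (p i) * f \<omega> (p j))))"
    by (simp add: mult_ac)
  also have "\<dots> = (\<Sum>i\<in>J. \<Sum>j\<in>J. c i * c j * K (p i - p j))"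
    by (simp only: Bochner_Integration.integral_mult_right_zero expectation_value_mult)
  finally show ?thesis .
qed

lemma expectation_increment_square:
  "expectation (\<lambda>\<omega>. (f \<omega> (x + h) - f \<omega> x)\<^sup>2) = 2 * (K 0 - K h)"
  using expectation_lincomb_square[of "{True, False}" "\<lambda>i. if i then 1 else - 1"
      "\<lambda>i. if i then x + h else x"] covariance_minus[of h]
  by simp

lemma lincombs_char:
  assumes "Z \<in> lincombs"
  shows "(CLINT \<omega>|M. iexp (Z \<omega>)) = exp (- expectation (\<lambda>\<omega>. (Z \<omega>)\<^sup>2) / 2)"
  using centered_normal_moments(3)[OF lincombs_centered_normal[OF assms], of 1] by simp

text \<open>Characteristic functions converge under almost sure convergence because they are bounded
  by 1. For a centered normal law the value at 1 is exp(- variance / 2), from which the variance is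
  recovered by a logarithm; no uniform integrability has to be established.\<close>

lemma lincombs_AE_tendsto_0:
  assumes Z: "\<And>n. Z n \<in> lincombs" and lim: "AE \<omega> in M. (\<lambda>n. Z n \<omega>) \<longlonglongrightarrow> 0"
  shows "(\<lambda>n. expectation (\<lambda>\<omega>. (Z n \<omega>)\<^sup>2)) \<longlonglongrightarrow> 0"
proof -
  note [measurable] = lincombs_measurable[OF Z]
  have "(\<lambda>n. CLINT \<omega>|M. iexp (Z n \<omega>)) \<longlonglongrightarrow> (CLINT \<omega>|M. 1)"
  proof (rule integral_dominated_convergence[where w = "\<lambda>_. 1"])
    show "AE \<omega> in M. (\<lambda>n. iexp (Z n \<omega>)) \<longlonglongrightarrow> 1"
      using lim
    proof eventually_elim
      fix \<omega> assume "(\<lambda>n. Z n \<omega>) \<longlonglongrightarrow> 0"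
      then have "(\<lambda>n. iexp (Z n \<omega>)) \<longlonglongrightarrow> iexp 0"
        by (intro tendsto_intros)
      then show "(\<lambda>n. iexp (Z n \<omega>)) \<longlonglongrightarrow> 1" by simp
    qed
  qed auto
  then have "(\<lambda>n. Re (CLINT \<omega>|M. iexp (Z n \<omega>))) \<longlonglongrightarrow> Re (CLINT \<omega>|M. 1)"
    by (rule tendsto_Re)
  then have "(\<lambda>n. exp (- expectation (\<lambda>\<omega>. (Z n \<omega>)\<^sup>2) / 2)) \<longlonglongrightarrow> 1"
    by (simp add: lincombs_char[OF Z] prob_space)
  then have "(\<lambda>n. - 2 * ln (exp (- expectation (\<lambda>\<omega>. (Z n \<omega>)\<^sup>2) / 2))) \<longlonglongrightarrow> - 2 * ln 1"
    by (intro tendsto_intros) auto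
  then show ?thesis by simp
qed

lemma lincombs_cauchy_schwarz:
  assumes "X \<in> lincombs" "Y \<in> lincombs"
  shows "(expectation (\<lambda>\<omega>. X \<omega> * Y \<omega>))\<^sup>2 \<le>
    expectation (\<lambda>\<omega>. (X \<omega>)\<^sup>2) * expectation (\<lambda>\<omega>. (Y \<omega>)\<^sup>2)"
proof -
  define A B C where "A = expectation (\<lambda>\<omega>. (X \<omega>)\<^sup>2)" and "B = expectation (\<lambda>\<omega>. X \<omega> * Y \<omega>)"
    and "C = expectation (\<lambda>\<omega>. (Y \<omega>)\<^sup>2)"
  note int = lincombs_integrable_square[OF assms(1)] lincombs_integrable_square[OF assms(2)]
    lincombs_integrable_mult[OF assms]
  have quad: "0 \<le> t\<^sup>2 * A + 2 * t * B + C" for t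
  proof -
    have "0 \<le> expectation (\<lambda>\<omega>. (t * X \<omega> + Y \<omega>)\<^sup>2)" by simp
    also have "\<dots> = expectation (\<lambda>\<omega>. t\<^sup>2 * (X \<omega>)\<^sup>2 + 2 * t * (X \<omega> * Y \<omega>) + (Y \<omega>)\<^sup>2)"
      by (simp add: power2_sum power_mult_distrib algebra_simps)
    also have "\<dots> = t\<^sup>2 * A + 2 * t * B + C"
      using int by (simp add: A_def B_def C_def)
    finally show ?thesis .
  qed
  have "A \<ge> 0" by (simp add: A_def)
  have "B\<^sup>2 \<le> A * C"
  proof (cases "A = 0")
    case True
    \<comment> \<open>For A = 0 the quadratic is the affine function 2 t B + C; the chosen t would
      give it the value -1.\<close>
    have "B = 0"
    proof (rule ccontr)
      assume "B \<noteq> 0"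
      then have "2 * (- (C + 1) / (2 * B)) * B = - (C + 1)"
        by simp
      then show False
        using quad[of "- (C + 1) / (2 * B)"] True by simp
    qed
    then show ?thesis using True by simp
  next
    case False
    then have "A > 0" using \<open>A \<ge> 0\<close> by simp
    then show ?thesis
      using quad[of "- B / A"] by (simp add: field_simps power2_eq_square)
  qed
  then show ?thesis by (simp add: A_def B_def C_def)
qed

text \<open>Applied with X = f(0), this turns statements on the paths into statements on
  \<open>K\<close>, because the covariance of f(x) with f(0) is K(x).\<close>

lemma lincombs_covariance_tendsto_0:
  assumes X: "X \<in> lincombs" and Y: "\<And>n. Y n \<in> lincombs"
    and lim: "(\<lambda>n. expectation (\<lambda>\<omega>. (Y n \<omega>)\<^sup>2)) \<longlonglongrightarrow> 0"
  shows "(\<lambda>n. expectation (\<lambda>\<omega>. X \<omega> * Y n \<omega>)) \<longlonglongrightarrow> 0"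
proof -
  let ?A = "expectation (\<lambda>\<omega>. (X \<omega>)\<^sup>2)"
  have "(\<lambda>n. sqrt (?A * expectation (\<lambda>\<omega>. (Y n \<omega>)\<^sup>2))) \<longlonglongrightarrow> sqrt (?A * 0)"
    by (intro tendsto_intros lim)
  then have "(\<lambda>n. sqrt (?A * expectation (\<lambda>\<omega>. (Y n \<omega>)\<^sup>2))) \<longlonglongrightarrow> 0"
    by simp
  then show ?thesis
  proof (rule Lim_null_comparison[rotated], intro always_eventually allI)
    fix n
    show "norm (expectation (\<lambda>\<omega>. X \<omega> * Y n \<omega>)) \<le> sqrt (?A * expectation (\<lambda>\<omega>. (Y n \<omega>)\<^sup>2))"
      using real_sqrt_le_mono[OF lincombs_cauchy_schwarz[OF X Y[of n]]] by simp
  qed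
qed

end

section \<open>Regularity of the covariance and variances of differences\<close>

lemma directional_quotient_tendsto:
  fixes g :: "'a::real_normed_vector \<Rightarrow> real"
  assumes "(g has_derivative F) (at x)"
  shows "((\<lambda>t. (g (x + t *\<^sub>R v) - g x) / t) \<longlongrightarrow> F v) (at 0)"
proof -
  have "((\<lambda>t. g (x + t *\<^sub>R v)) has_derivative (\<lambda>t. F (t *\<^sub>R v))) (at 0)"
    using assms by (intro has_derivative_compose[of _ _ 0 UNIV g F]) (auto intro!: derivative_eq_intros)
  moreover have "(\<lambda>t. F (t *\<^sub>R v)) = (*) (F v)"
    using linear_scale[OF has_derivative_linear[OF assms]] by auto
  ultimately show ?thesis
    by (simp add: has_field_derivative_def[symmetric] DERIV_def)
qed

context centered_gaussian_field
begin

text \<open>Pairing the first-order expansion of the path at x with f(0) gives the first-order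
  expansion of \<open>K\<close> at x. The candidate partial derivatives are limits of covariances of
  difference quotients with f(0).\<close>

lemma covariance_differentiable:
  assumes diff: "AE \<omega> in M. f \<omega> differentiable (at x)"
  shows "K differentiable (at x)"
proof -
  define \<tau> :: "nat \<Rightarrow> real" where "\<tau> n = inverse (real (Suc n))" for n
  define D where "D i n \<omega> = (f \<omega> (x + \<tau> n *\<^sub>R i) - f \<omega> x) / \<tau> n" for i n \<omega>
  define d where "d i n = expectation (\<lambda>\<omega>. f \<omega> 0 * D i n \<omega>)" for i n
  have \<tau>: "\<tau> \<longlonglongrightarrow> 0"
    unfolding \<tau>_def by (rule LIMSEQ_inverse_real_of_nat)
  have D_lincombs: "D i n \<in> lincombs" for i n
    unfolding D_def[abs_def] by (intro lincombs_intros)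
  have D_lim: "(\<lambda>n. D i n \<omega>) \<longlonglongrightarrow> F i" if "(f \<omega> has_derivative F) (at x)" for i \<omega> F
    unfolding D_def
    by (intro filterlim_compose[OF directional_quotient_tendsto[OF that]] filterlim_atI \<tau>)
      (simp add: \<tau>_def)
  \<comment> \<open>The almost sure limit of the quotients is a derivative, which need not lie in
    \<open>lincombs\<close>. Differences of two quotients do lie there and tend to 0, so the limit
    of the covariances is obtained by the Cauchy criterion.\<close>
  have "Cauchy (d i)" for i
  proof (rule ccontr)
    assume "\<not> Cauchy (d i)"
    then obtain e where "e > 0" and "\<And>N. \<exists>m n. m \<ge> N \<and> n \<ge> N \<and> \<not> dist (d i m) (d i n) < e"
      unfolding Cauchy_def by blast
    then obtain m n where mn: "\<And>N. m N \<ge> N" "\<And>N. n N \<ge> N"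
      and e: "\<And>N. \<not> dist (d i (m N)) (d i (n N)) < e"
      by metis
    let ?Y = "\<lambda>N \<omega>. D i (m N) \<omega> - D i (n N) \<omega>"
    have Y: "?Y N \<in> lincombs" for N
      by (intro lincombs_diff D_lincombs)
    have at_top: "filterlim m at_top sequentially" "filterlim n at_top sequentially"
      using mn by (auto intro: filterlim_at_top_mono[OF filterlim_ident])
    have "AE \<omega> in M. (\<lambda>N. ?Y N \<omega>) \<longlonglongrightarrow> 0"
      using diff
    proof eventually_elim
      fix \<omega> assume "f \<omega> differentiable (at x)"
      then obtain F where F: "(f \<omega> has_derivative F) (at x)"
        by (auto simp: differentiable_def)
      have "(\<lambda>N. ?Y N \<omega>) \<longlonglongrightarrow> F i - F i"
        by (intro tendsto_diff filterlim_compose[OF D_lim[OF F]] at_top)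
      then show "(\<lambda>N. ?Y N \<omega>) \<longlonglongrightarrow> 0" by simp
    qed
    then have "(\<lambda>N. expectation (\<lambda>\<omega>. f \<omega> 0 * ?Y N \<omega>)) \<longlonglongrightarrow> 0"
      by (intro lincombs_covariance_tendsto_0 lincombs_AE_tendsto_0 Y lincombs_value)
    moreover have "expectation (\<lambda>\<omega>. f \<omega> 0 * ?Y N \<omega>) = d i (m N) - d i (n N)" for N
      unfolding d_def right_diff_distrib
      by (intro Bochner_Integration.integral_diff lincombs_integrable_mult lincombs_value D_lincombs)
    ultimately have "(\<lambda>N. d i (m N) - d i (n N)) \<longlonglongrightarrow> 0"
      by simp
    then have "eventually (\<lambda>N. norm (d i (m N) - d i (n N)) < e) sequentially"
      using \<open>e > 0\<close> by (auto dest: tendstoD simp: dist_norm)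
    then show False
      using e by (auto simp: dist_norm eventually_sequentially)
  qed
  then have "\<forall>i. \<exists>l. d i \<longlonglongrightarrow> l"
    using Cauchy_convergent by (auto simp: convergent_def)
  then obtain l where l: "\<And>i. d i \<longlonglongrightarrow> l i" by metis
  define L where "L h = (\<Sum>i\<in>Basis. (h \<bullet> i) * l i)" for h :: 'a
  have "(K has_derivative L) (at x)"
    unfolding has_derivative_at
  proof
    show "bounded_linear L"
      unfolding L_def by (intro bounded_linear_intros)
    show "(\<lambda>h. norm (K (x + h) - K x - L h) / norm h) \<midarrow>0\<rightarrow> 0"
      unfolding tendsto_at_iff_sequentially o_def
    proof safe
      fix X :: "nat \<Rightarrow> 'a"
      assume X0: "\<forall>n. X n \<in> UNIV - {0}" and X: "X \<longlonglongrightarrow> 0"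
      then have nz: "X n \<noteq> 0" for n by auto
      have bounded_coord: "\<bar>(X n \<bullet> i) / norm (X n)\<bar> \<le> 1" if "i \<in> Basis" for n i
        using nz[of n] Basis_le_norm[OF that, of "X n"] by simp
      have coord_null: "(\<lambda>n. (X n \<bullet> i) / norm (X n) * b n) \<longlonglongrightarrow> 0" if "i \<in> Basis" "b \<longlonglongrightarrow> 0" for i b
      proof (rule Lim_null_comparison)
        show "\<forall>\<^sub>F n in sequentially. norm ((X n \<bullet> i) / norm (X n) * b n) \<le> norm (b n)"
          using mult_right_mono[OF bounded_coord[OF that(1)]]
          by (intro always_eventually allI) (simp add: abs_mult)
        show "(\<lambda>n. norm (b n)) \<longlonglongrightarrow> 0"
          using that(2) by (rule tendsto_norm_zero)
      qed
      \<comment> \<open>The remainder is formed with quotients in place of partial derivatives in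
        order to remain in \<open>lincombs\<close>. The replacement costs terms F i - D i n, which
        tend to 0 and are weighted by coordinates of a unit vector.\<close>
      define R where "R n \<omega> = (f \<omega> (x + X n) - f \<omega> x - (\<Sum>i\<in>Basis. (X n \<bullet> i) * D i n \<omega>)) / norm (X n)" for n \<omega>
      have R: "R n \<in> lincombs" for n
        unfolding R_def[abs_def] by (intro lincombs_intros D_lincombs finite_Basis)
      have "AE \<omega> in M. (\<lambda>n. R n \<omega>) \<longlonglongrightarrow> 0"
        using diff
      proof eventually_elim
        fix \<omega> assume "f \<omega> differentiable (at x)"
        then obtain F where F: "(f \<omega> has_derivative F) (at x)"
          by (auto simp: differentiable_def)
        have "(\<lambda>h. norm (f \<omega> (x + h) - f \<omega> x - F h) / norm h) \<midarrow>0\<rightarrow> 0"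
          using F by (simp add: has_derivative_at)
        then have "(\<lambda>n. norm (f \<omega> (x + X n) - f \<omega> x - F (X n)) / norm (X n)) \<longlonglongrightarrow> 0"
          using X0 X unfolding tendsto_at_iff_sequentially o_def by auto
        then have "(\<lambda>n. norm ((f \<omega> (x + X n) - f \<omega> x - F (X n)) / norm (X n))) \<longlonglongrightarrow> 0"
          by simp
        then have "(\<lambda>n. (f \<omega> (x + X n) - f \<omega> x - F (X n)) / norm (X n)) \<longlonglongrightarrow> 0"
          by (rule tendsto_norm_zero_cancel)
        moreover have "(\<lambda>n. \<Sum>i\<in>Basis. (X n \<bullet> i) / norm (X n) * (F i - D i n \<omega>)) \<longlonglongrightarrow> 0"
          using tendsto_diff[OF tendsto_const D_lim[OF F]]
          by (intro tendsto_null_sum coord_null) (metis diff_self)+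
        moreover have "F (X n) = (\<Sum>i\<in>Basis. (X n \<bullet> i) * F i)" for n
          using linear_sum[OF has_derivative_linear[OF F], of "\<lambda>i. (X n \<bullet> i) *\<^sub>R i" Basis]
          by (simp add: euclidean_representation linear_scale[OF has_derivative_linear[OF F]])
        then have "R n \<omega> = (f \<omega> (x + X n) - f \<omega> x - F (X n)) / norm (X n) +
            (\<Sum>i\<in>Basis. (X n \<bullet> i) / norm (X n) * (F i - D i n \<omega>))" for n
          by (simp add: R_def diff_divide_distrib right_diff_distrib sum_subtractf sum_divide_distrib)
        ultimately show "(\<lambda>n. R n \<omega>) \<longlonglongrightarrow> 0"
          using tendsto_add by fastforce
      qed
      then have "(\<lambda>n. expectation (\<lambda>\<omega>. f \<omega> 0 * R n \<omega>)) \<longlonglongrightarrow> 0"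
        by (intro lincombs_covariance_tendsto_0 lincombs_AE_tendsto_0 R lincombs_value)
      moreover have "expectation (\<lambda>\<omega>. f \<omega> 0 * R n \<omega>) =
          (K (x + X n) - K x - (\<Sum>i\<in>Basis. (X n \<bullet> i) * d i n)) / norm (X n)" for n
      proof -
        have "expectation (\<lambda>\<omega>. f \<omega> 0 * R n \<omega>) =
          expectation (\<lambda>\<omega>. (f \<omega> (x + X n) * f \<omega> 0 - f \<omega> x * f \<omega> 0 -
            (\<Sum>i\<in>Basis. (X n \<bullet> i) * (f \<omega> 0 * D i n \<omega>))) / norm (X n))"
          by (simp add: R_def right_diff_distrib sum_distrib_left mult_ac)
        also have "\<dots> = (expectation (\<lambda>\<omega>. f \<omega> (x + X n) * f \<omega> 0) - expectation (\<lambda>\<omega>. f \<omega> x * f \<omega> 0) -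
            (\<Sum>i\<in>Basis. (X n \<bullet> i) * expectation (\<lambda>\<omega>. f \<omega> 0 * D i n \<omega>))) / norm (X n)"
          using lincombs_integrable_mult lincombs_value D_lincombs
          by (simp add: Bochner_Integration.integral_diff Bochner_Integration.integral_sum
              Bochner_Integration.integrable_diff Bochner_Integration.integrable_sum)
        finally show ?thesis by (simp add: expectation_value_mult d_def)
      qed
      ultimately have "(\<lambda>n. (K (x + X n) - K x - (\<Sum>i\<in>Basis. (X n \<bullet> i) * d i n)) / norm (X n)) \<longlonglongrightarrow> 0"
        by simp
      moreover have "(\<lambda>n. \<Sum>i\<in>Basis. (X n \<bullet> i) / norm (X n) * (d i n - l i)) \<longlonglongrightarrow> 0"
        by (intro tendsto_null_sum coord_null LIM_zero l)
      ultimately have "(\<lambda>n. (K (x + X n) - K x - (\<Sum>i\<in>Basis. (X n \<bullet> i) * d i n)) / norm (X n) +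
          (\<Sum>i\<in>Basis. (X n \<bullet> i) / norm (X n) * (d i n - l i))) \<longlonglongrightarrow> 0 + 0"
        by (rule tendsto_add)
      moreover have "(K (x + X n) - K x - (\<Sum>i\<in>Basis. (X n \<bullet> i) * d i n)) / norm (X n) +
          (\<Sum>i\<in>Basis. (X n \<bullet> i) / norm (X n) * (d i n - l i)) = (K (x + X n) - K x - L (X n)) / norm (X n)" for n
        by (simp add: L_def diff_divide_distrib right_diff_distrib sum_subtractf sum_divide_distrib)
      ultimately have "(\<lambda>n. norm ((K (x + X n) - K x - L (X n)) / norm (X n))) \<longlonglongrightarrow> 0"
        by (intro tendsto_norm_zero) simp
      then show "(\<lambda>n. norm (K (x + X n) - K x - L (X n)) / norm (X n)) \<longlonglongrightarrow> 0"
        by simp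
    qed
  qed
  then show ?thesis
    by (auto simp: differentiable_def)
qed

end

section \<open>Smooth functions along lines\<close>

lemma class_C_Suc_imp: "class_C (Suc k) g \<Longrightarrow> class_C k g"
proof (induction k arbitrary: g)
  case 0
  then show ?case
    by (auto intro!: continuous_at_imp_continuous_on differentiable_imp_continuous_within)
qed auto

lemma differentiable_line_has_derivative:
  assumes "\<And>x. g differentiable (at x)"
  shows "((\<lambda>t. g (x + t *\<^sub>R v)) has_real_derivative frechet_derivative g (at (x + t *\<^sub>R v)) v) (at t)"
proof -
  have F: "(g has_derivative frechet_derivative g (at (x + t *\<^sub>R v))) (at (x + t *\<^sub>R v))"
    using assms frechet_derivative_works by blast
  have "((\<lambda>s. g (x + s *\<^sub>R v)) has_derivative (\<lambda>s. frechet_derivative g (at (x + t *\<^sub>R v)) (s *\<^sub>R v))) (at t)"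
    by (rule has_derivative_compose[of "\<lambda>s. x + s *\<^sub>R v" _ t UNIV g, OF _ F]) (auto intro!: derivative_eq_intros)
  moreover have "(\<lambda>s. frechet_derivative g (at (x + t *\<^sub>R v)) (s *\<^sub>R v)) =
      (*) (frechet_derivative g (at (x + t *\<^sub>R v)) v)"
    using linear_scale[OF has_derivative_linear[OF F]] by auto
  ultimately show ?thesis
    by (simp add: has_field_derivative_def)
qed

lemma class_C_2_line:
  assumes "class_C 2 g"
  obtains g1 g2 where "\<And>t. ((\<lambda>t. g (x + t *\<^sub>R v)) has_real_derivative g1 t) (at t)"
    and "\<And>t. (g1 has_real_derivative g2 t) (at t)" and "continuous_on UNIV g2"
proof -
  let ?g1 = "\<lambda>x. frechet_derivative g (at x) v"
  let ?g2 = "\<lambda>x. frechet_derivative ?g1 (at x) v"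
  have C: "\<And>x. g differentiable (at x)" "\<And>x. ?g1 differentiable (at x)" "continuous_on UNIV ?g2"
    using assms by (auto simp: numeral_2_eq_2)
  show ?thesis
  proof (rule that)
    show "((\<lambda>t. g (x + t *\<^sub>R v)) has_real_derivative ?g1 (x + t *\<^sub>R v)) (at t)" for t
      by (rule differentiable_line_has_derivative[OF C(1)])
    show "((\<lambda>t. ?g1 (x + t *\<^sub>R v)) has_real_derivative ?g2 (x + t *\<^sub>R v)) (at t)" for t
      by (rule differentiable_line_has_derivative[OF C(2)])
    show "continuous_on UNIV (\<lambda>t. ?g2 (x + t *\<^sub>R v))"
      by (intro continuous_on_compose2[OF C(3)] continuous_intros) auto
  qed
qed

text \<open>The second difference is the increment over [0, \<tau>] of s -> g(s + \<tau>) - g(s), so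
  the mean value theorem applies twice.\<close>

lemma second_difference_mean_value:
  fixes g :: "real \<Rightarrow> real"
  assumes g1: "\<And>t. (g has_real_derivative g1 t) (at t)"
    and g2: "\<And>t. (g1 has_real_derivative g2 t) (at t)" and "\<tau> > 0"
  obtains \<theta> where "0 < \<theta>" "\<theta> < 2 * \<tau>" "(g (2 * \<tau>) - 2 * g \<tau> + g 0) / \<tau>\<^sup>2 = g2 \<theta>"
proof -
  have "((\<lambda>s. g (s + \<tau>) - g s) has_real_derivative g1 (s + \<tau>) - g1 s) (at s)" for s
    by (intro DERIV_diff g1) (use DERIV_shift[of g "g1 (s + \<tau>)" s \<tau>] g1 in auto)
  then obtain \<xi> where \<xi>: "0 < \<xi>" "\<xi> < \<tau>"
    "(g (\<tau> + \<tau>) - g \<tau>) - (g (0 + \<tau>) - g 0) = (\<tau> - 0) * (g1 (\<xi> + \<tau>) - g1 \<xi>)"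
    using MVT2[of 0 \<tau> "\<lambda>s. g (s + \<tau>) - g s" "\<lambda>s. g1 (s + \<tau>) - g1 s"] \<open>\<tau> > 0\<close> by auto
  obtain \<theta> where \<theta>: "\<xi> < \<theta>" "\<theta> < \<xi> + \<tau>" "g1 (\<xi> + \<tau>) - g1 \<xi> = (\<xi> + \<tau> - \<xi>) * g2 \<theta>"
    using MVT2[of \<xi> "\<xi> + \<tau>" g1 g2] \<open>\<tau> > 0\<close> g2 by auto
  have double: "2 * \<tau> = \<tau> + \<tau>" by simp
  have "(g (\<tau> + \<tau>) - g \<tau>) - (g \<tau> - g 0) = \<tau> * (\<tau> * g2 \<theta>)"
    using \<xi>(3) \<theta>(3) by simp
  then have "g (2 * \<tau>) - 2 * g \<tau> + g 0 = g2 \<theta> * \<tau>\<^sup>2"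
    unfolding double power2_eq_square by (simp add: algebra_simps)
  then have "(g (2 * \<tau>) - 2 * g \<tau> + g 0) / \<tau>\<^sup>2 = g2 \<theta>"
    using \<open>\<tau> > 0\<close> by simp
  moreover have "0 < \<theta>" "\<theta> < 2 * \<tau>"
    using \<xi>(1,2) \<theta>(1,2) by linarith+
  ultimately show ?thesis
    by (intro that)
qed

lemma second_difference_tendsto:
  fixes g :: "real \<Rightarrow> real"
  assumes g1: "\<And>t. (g has_real_derivative g1 t) (at t)"
    and g2: "\<And>t. (g1 has_real_derivative g2 t) (at t)" and cont: "continuous_on UNIV g2"
    and \<tau>: "\<tau> \<longlonglongrightarrow> 0" "\<And>n. \<tau> n > 0"
  shows "(\<lambda>n. (g (2 * \<tau> n) - 2 * g (\<tau> n) + g 0) / (\<tau> n)\<^sup>2) \<longlonglongrightarrow> g2 0"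
proof -
  have "\<exists>\<theta>. 0 < \<theta> \<and> \<theta> < 2 * \<tau> n \<and> (g (2 * \<tau> n) - 2 * g (\<tau> n) + g 0) / (\<tau> n)\<^sup>2 = g2 \<theta>" for n
    by (rule second_difference_mean_value[OF g1 g2 \<tau>(2)]) blast
  then obtain \<theta> where \<theta>: "\<And>n. 0 < \<theta> n" "\<And>n. \<theta> n < 2 * \<tau> n"
    and eq: "\<And>n. (g (2 * \<tau> n) - 2 * g (\<tau> n) + g 0) / (\<tau> n)\<^sup>2 = g2 (\<theta> n)"
    by metis
  have "(\<lambda>n. 2 * \<tau> n) \<longlonglongrightarrow> 2 * 0"
    by (intro tendsto_intros \<tau>)
  then have "\<theta> \<longlonglongrightarrow> 0"
    by (intro tendsto_sandwich[of "\<lambda>_. 0" \<theta> _ "\<lambda>n. 2 * \<tau> n"]) (auto simp: less_imp_le \<theta>)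
  then show ?thesis
    unfolding eq by (rule continuous_on_tendsto_compose[OF cont]) auto
qed

locale smooth_gaussian_field = centered_gaussian_field +
  assumes class_C_2: "AE \<omega> in M. class_C 2 (f \<omega>)"
    and normalized: "K 0 = 1"
    and nondegenerate: "nondegenerate_at_order 1 K"
begin

lemma covariance_has_derivative: "(K has_derivative frechet_derivative K (at x)) (at x)"
proof -
  have "AE \<omega> in M. f \<omega> differentiable (at x)"
    using class_C_2 by eventually_elim (simp add: numeral_2_eq_2)
  then show ?thesis
    using covariance_differentiable frechet_derivative_works by blast
qed

lemma covariance_continuous: "isCont K x"
  by (rule has_derivative_continuous[OF covariance_has_derivative])

text \<open>An increment over n h is a sum of n increments of equal variance, and (sum)^2 <= n *
  (sum of squares). The factor n^2 is the scaling of a squared length, so a small ratio of variance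
  to squared length at one scale passes to all its multiples.\<close>

lemma increment_variance_multiple:
  "2 * (K 0 - K (real n *\<^sub>R h)) \<le> (real n)\<^sup>2 * (2 * (K 0 - K h))"
proof -
  have eq: "f \<omega> (0 + real n *\<^sub>R h) - f \<omega> 0 = (\<Sum>k<n. f \<omega> (real k *\<^sub>R h + h) - f \<omega> (real k *\<^sub>R h))" for \<omega>
    using sum_lessThan_telescope[of "\<lambda>k. f \<omega> (real k *\<^sub>R h)" n]
    by (simp add: scaleR_left_distrib add.commute)
  have int: "integrable M (\<lambda>\<omega>. (f \<omega> (real k *\<^sub>R h + h) - f \<omega> (real k *\<^sub>R h))\<^sup>2)" for k
    by (intro lincombs_integrable_square lincombs_intros)
  have "2 * (K 0 - K (real n *\<^sub>R h)) =
      expectation (\<lambda>\<omega>. (\<Sum>k<n. f \<omega> (real k *\<^sub>R h + h) - f \<omega> (real k *\<^sub>R h))\<^sup>2)"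
    unfolding expectation_increment_square[of 0, symmetric] eq ..
  also have "\<dots> \<le> expectation (\<lambda>\<omega>. (\<Sum>k<n. (f \<omega> (real k *\<^sub>R h + h) - f \<omega> (real k *\<^sub>R h))\<^sup>2) * real n)"
  proof (rule integral_mono)
    show "integrable M (\<lambda>\<omega>. (\<Sum>k<n. f \<omega> (real k *\<^sub>R h + h) - f \<omega> (real k *\<^sub>R h))\<^sup>2)"
      by (intro lincombs_integrable_square lincombs_intros finite_lessThan)
    show "integrable M (\<lambda>\<omega>. (\<Sum>k<n. (f \<omega> (real k *\<^sub>R h + h) - f \<omega> (real k *\<^sub>R h))\<^sup>2) * real n)"
      using int by simp
    show "(\<Sum>k<n. f \<omega> (real k *\<^sub>R h + h) - f \<omega> (real k *\<^sub>R h))\<^sup>2 \<le>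
        (\<Sum>k<n. (f \<omega> (real k *\<^sub>R h + h) - f \<omega> (real k *\<^sub>R h))\<^sup>2) * real n" for \<omega>
      using sum_squared_le_sum_of_squares[of "\<lambda>k. f \<omega> (real k *\<^sub>R h + h) - f \<omega> (real k *\<^sub>R h)" "{..<n}"] by simp
  qed
  also have "\<dots> = (\<Sum>k<n. expectation (\<lambda>\<omega>. (f \<omega> (real k *\<^sub>R h + h) - f \<omega> (real k *\<^sub>R h))\<^sup>2)) * real n"
    using int by simp
  also have "\<dots> = (real n)\<^sup>2 * (2 * (K 0 - K h))"
    by (simp add: expectation_increment_square) (simp add: power2_eq_square)
  finally show ?thesis .
qed

text \<open>If the ratio of variance to \<tau>^2 were arbitrarily small along steps tending to 0,
  filling a length T with such steps would force the increment over T to have variance 0. Then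
  \<open>K\<close> is constant along v, against non-degeneracy at order 1. The argument by
  contradiction avoids a second-order expansion of \<open>K\<close>.\<close>

lemma increment_variance_lower_bound:
  assumes "v \<noteq> 0"
  shows "\<exists>c>0. \<exists>\<tau>\<^sub>0>0. \<forall>\<tau>. 0 < \<tau> \<and> \<tau> < \<tau>\<^sub>0 \<longrightarrow> c * \<tau>\<^sup>2 \<le> 2 * (K 0 - K (\<tau> *\<^sub>R v))"
proof (rule ccontr)
  assume contra: "\<not> ?thesis"
  have "\<exists>\<tau>. 0 < \<tau> \<and> \<tau> < inverse (real (Suc n)) \<and>
      2 * (K 0 - K (\<tau> *\<^sub>R v)) < inverse (real (Suc n)) * \<tau>\<^sup>2" for n
  proof -
    have "inverse (real (Suc n)) > 0" by simp
    with contra have "\<not> (\<forall>\<tau>. 0 < \<tau> \<and> \<tau> < inverse (real (Suc n)) \<longrightarrow>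
        inverse (real (Suc n)) * \<tau>\<^sup>2 \<le> 2 * (K 0 - K (\<tau> *\<^sub>R v)))"
      by blast
    then show ?thesis by (simp only: not_all not_imp not_le conj_assoc)
  qed
  then obtain \<tau> where \<tau>: "\<And>n. 0 < \<tau> n" "\<And>n. \<tau> n < inverse (real (Suc n))"
    and small: "\<And>n. 2 * (K 0 - K (\<tau> n *\<^sub>R v)) < inverse (real (Suc n)) * (\<tau> n)\<^sup>2"
    by metis
  have "\<tau> \<longlonglongrightarrow> 0"
    by (rule tendsto_sandwich[OF _ _ tendsto_const LIMSEQ_inverse_real_of_nat])
      (simp_all only: \<tau> less_imp_le eventually_True)
  have "K (T *\<^sub>R v) = K 0" if "T \<ge> 0" for T
  proof -
    \<comment> \<open>The number of whole steps \<tau> n that fit into T; they end within \<tau> n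
      of T, and continuity of \<open>K\<close> closes the gap.\<close>
    define N where "N n = nat \<lfloor>T / \<tau> n\<rfloor>" for n
    have N: "real (N n) * \<tau> n \<le> T" "T - \<tau> n \<le> real (N n) * \<tau> n" for n
    proof -
      have "real (N n) \<le> T / \<tau> n" "T / \<tau> n - 1 \<le> real (N n)"
        using that \<tau>(1)[of n] by (auto simp: N_def)
      then show "real (N n) * \<tau> n \<le> T" "T - \<tau> n \<le> real (N n) * \<tau> n"
        using \<tau>(1)[of n] by (auto simp: field_simps)
    qed
    have "(\<lambda>n. T - \<tau> n) \<longlonglongrightarrow> T - 0"
      by (intro tendsto_intros \<open>\<tau> \<longlonglongrightarrow> 0\<close>)
    then have "(\<lambda>n. T - \<tau> n) \<longlonglongrightarrow> T" by simp
    then have "(\<lambda>n. real (N n) * \<tau> n) \<longlonglongrightarrow> T"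
      by (rule tendsto_sandwich[OF _ _ _ tendsto_const, rotated 2]) (simp_all add: N)
    then have "(\<lambda>n. 2 * (K 0 - K ((real (N n) * \<tau> n) *\<^sub>R v))) \<longlonglongrightarrow> 2 * (K 0 - K (T *\<^sub>R v))"
      by (intro tendsto_intros isCont_tendsto_compose[OF covariance_continuous])
    moreover have "(\<lambda>n. T\<^sup>2 * inverse (real (Suc n))) \<longlonglongrightarrow> T\<^sup>2 * 0"
      by (intro tendsto_intros LIMSEQ_inverse_real_of_nat)
    moreover have "2 * (K 0 - K ((real (N n) * \<tau> n) *\<^sub>R v)) \<le> T\<^sup>2 * inverse (real (Suc n))" for n
    proof -
      have "2 * (K 0 - K ((real (N n) * \<tau> n) *\<^sub>R v)) \<le> (real (N n))\<^sup>2 * (2 * (K 0 - K (\<tau> n *\<^sub>R v)))"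
        using increment_variance_multiple[of "N n" "\<tau> n *\<^sub>R v"] by simp
      also have "\<dots> \<le> (real (N n))\<^sup>2 * (inverse (real (Suc n)) * (\<tau> n)\<^sup>2)"
        using small[of n] by (intro mult_left_mono) auto
      also have "\<dots> = (real (N n) * \<tau> n)\<^sup>2 * inverse (real (Suc n))"
        by (simp add: power_mult_distrib)
      also have "\<dots> \<le> T\<^sup>2 * inverse (real (Suc n))"
        using N(1)[of n] \<tau>(1)[of n] by (intro mult_right_mono power_mono) auto
      finally show ?thesis .
    qed
    ultimately have "2 * (K 0 - K (T *\<^sub>R v)) \<le> T\<^sup>2 * 0"
      by (intro LIMSEQ_le) auto
    moreover have "2 * (K 0 - K (T *\<^sub>R v)) \<ge> 0"
      unfolding expectation_increment_square[of 0, symmetric] by simp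
    ultimately show ?thesis by simp
  qed
  \<comment> \<open>So far \<open>K\<close> is constant only on the ray from 0. An increment along v
    has variance 0 from any starting point, hence by Cauchy-Schwarz no covariance with f(0), and
    \<open>K\<close> is constant along every line in direction v.\<close>
  then have invariant_pos: "K (x + T *\<^sub>R v) = K x" if "T \<ge> 0" for x T
  proof -
    let ?Y = "\<lambda>\<omega>. f \<omega> (x + T *\<^sub>R v) - f \<omega> x"
    have "K (x + T *\<^sub>R v) - K x = expectation (\<lambda>\<omega>. f \<omega> (x + T *\<^sub>R v) * f \<omega> 0) - expectation (\<lambda>\<omega>. f \<omega> x * f \<omega> 0)"
      by (simp add: expectation_value_mult)
    also have "\<dots> = expectation (\<lambda>\<omega>. f \<omega> 0 * ?Y \<omega>)"
      by (subst Bochner_Integration.integral_diff[symmetric])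
        (auto intro!: lincombs_integrable_mult lincombs_intros simp: algebra_simps)
    also have "(expectation (\<lambda>\<omega>. f \<omega> 0 * ?Y \<omega>))\<^sup>2 \<le> expectation (\<lambda>\<omega>. (f \<omega> 0)\<^sup>2) * expectation (\<lambda>\<omega>. (?Y \<omega>)\<^sup>2)"
      by (intro lincombs_cauchy_schwarz lincombs_intros)
    then have "expectation (\<lambda>\<omega>. f \<omega> 0 * ?Y \<omega>) = 0"
      using \<open>T \<ge> 0\<close> \<open>\<And>T. T \<ge> 0 \<Longrightarrow> K (T *\<^sub>R v) = K 0\<close> by (simp add: expectation_increment_square)
    finally show ?thesis by simp
  qed
  have invariant: "K (x + T *\<^sub>R v) = K x" for x T
    using invariant_pos[of T x] invariant_pos[of "- T" "x + T *\<^sub>R v"] by (cases "T \<ge> 0") auto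
  \<comment> \<open>Differentiability of \<open>K\<close> is essential here: without it
    \<open>frechet_derivative\<close> is an unspecified value, and constancy along v would say
    nothing about it.\<close>
  have "frechet_derivative K (at x) v = 0" for x
    using directional_quotient_tendsto[OF covariance_has_derivative, of x v]
    by (auto simp: invariant dest: LIM_const_eq)
  moreover have "higher_diff [v] K = (\<lambda>x. frechet_derivative K (at x) v)"
    by (simp add: fun_eq_iff) (simp add: higher_diff.simps(1)[abs_def])
  ultimately have "higher_diff [v] K = (\<lambda>x. 0)"
    by simp
  then have "higher_diff [v, v] K 0 = 0"
    by (subst higher_diff.simps) (simp only: frechet_derivative_const)
  moreover have "higher_diff [v, v] K 0 \<noteq> 0"
    using nondegenerate[unfolded nondegenerate_at_order_def, rule_format, of "[v]"] assms by simp
  ultimately show False by simp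
qed

text \<open>The covariance formula sees only differences of points. A bound at the origin is
  therefore uniform in the base point, and one constant serves all segments in direction v.\<close>

lemma second_difference_variance:
  "expectation (\<lambda>\<omega>. ((f \<omega> (x + (2 * \<tau>) *\<^sub>R v) - 2 * f \<omega> (x + \<tau> *\<^sub>R v) + f \<omega> x) / \<tau>\<^sup>2)\<^sup>2) =
   expectation (\<lambda>\<omega>. ((f \<omega> (y + (2 * \<tau>) *\<^sub>R v) - 2 * f \<omega> (y + \<tau> *\<^sub>R v) + f \<omega> y) / \<tau>\<^sup>2)\<^sup>2)"
proof -
  define c :: "nat \<Rightarrow> real" where "c i = (if i = 1 then - 2 else 1)" for i
  have *: "expectation (\<lambda>\<omega>. ((f \<omega> (x + (2 * \<tau>) *\<^sub>R v) - 2 * f \<omega> (x + \<tau> *\<^sub>R v) + f \<omega> x) / \<tau>\<^sup>2)\<^sup>2) =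
    (\<Sum>i\<in>{0,1,2}. \<Sum>j\<in>{0,1,2}. c i * c j * K ((real i * \<tau>) *\<^sub>R v - (real j * \<tau>) *\<^sub>R v)) / (\<tau>\<^sup>2)\<^sup>2" for x
  proof -
    have "expectation (\<lambda>\<omega>. (f \<omega> (x + (2 * \<tau>) *\<^sub>R v) - 2 * f \<omega> (x + \<tau> *\<^sub>R v) + f \<omega> x)\<^sup>2) =
        expectation (\<lambda>\<omega>. (\<Sum>i\<in>{0,1,2}. c i * f \<omega> (x + (real i * \<tau>) *\<^sub>R v))\<^sup>2)"
      by (simp add: c_def algebra_simps)
    also have "\<dots> = (\<Sum>i\<in>{0,1,2}. \<Sum>j\<in>{0,1,2}. c i * c j * K ((real i * \<tau>) *\<^sub>R v - (real j * \<tau>) *\<^sub>R v))"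
      by (subst expectation_lincomb_square) simp_all
    finally show ?thesis
      by (simp add: power_divide)
  qed
  show ?thesis
    unfolding * ..
qed

text \<open>If the variance exceeded (n+1)^2 at steps tending to 0, the second differences divided
  by n+1 would have variance at least 1. Yet they tend to 0 almost surely, because second
  differences of a C^2 path converge, and Gaussian variables tending to 0 have vanishing
  variance.\<close>

lemma second_difference_variance_bound:
  "\<exists>C\<ge>0. \<exists>\<tau>\<^sub>0>0. \<forall>x. \<forall>\<tau>. 0 < \<tau> \<and> \<tau> < \<tau>\<^sub>0 \<longrightarrow>
    expectation (\<lambda>\<omega>. ((f \<omega> (x + (2 * \<tau>) *\<^sub>R v) - 2 * f \<omega> (x + \<tau> *\<^sub>R v) + f \<omega> x) / \<tau>\<^sup>2)\<^sup>2) \<le> C"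
proof -
  define D where "D \<tau> \<omega> = (f \<omega> ((2 * \<tau>) *\<^sub>R v) - 2 * f \<omega> (\<tau> *\<^sub>R v) + f \<omega> 0) / \<tau>\<^sup>2" for \<tau> \<omega>
  have "\<exists>C\<ge>0. \<exists>\<tau>\<^sub>0>0. \<forall>\<tau>. 0 < \<tau> \<and> \<tau> < \<tau>\<^sub>0 \<longrightarrow> expectation (\<lambda>\<omega>. (D \<tau> \<omega>)\<^sup>2) \<le> C"
  proof (rule ccontr)
    assume contra: "\<not> ?thesis"
    have "\<exists>\<tau>. 0 < \<tau> \<and> \<tau> < inverse (real (Suc n)) \<and> (real (Suc n))\<^sup>2 < expectation (\<lambda>\<omega>. (D \<tau> \<omega>)\<^sup>2)" for n
    proof -
      have "inverse (real (Suc n)) > 0" "(real (Suc n))\<^sup>2 \<ge> 0" by simp_all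
      with contra have "\<not> (\<forall>\<tau>. 0 < \<tau> \<and> \<tau> < inverse (real (Suc n)) \<longrightarrow>
          expectation (\<lambda>\<omega>. (D \<tau> \<omega>)\<^sup>2) \<le> (real (Suc n))\<^sup>2)"
        by blast
      then show ?thesis by (simp only: not_all not_imp not_le conj_assoc)
    qed
    then obtain \<tau> where \<tau>: "\<And>n. 0 < \<tau> n" "\<And>n. \<tau> n < inverse (real (Suc n))"
      and large: "\<And>n. (real (Suc n))\<^sup>2 < expectation (\<lambda>\<omega>. (D (\<tau> n) \<omega>)\<^sup>2)"
      by metis
    have "\<tau> \<longlonglongrightarrow> 0"
      by (rule tendsto_sandwich[OF _ _ tendsto_const LIMSEQ_inverse_real_of_nat])
        (simp_all only: \<tau> less_imp_le eventually_True)
    let ?Y = "\<lambda>n \<omega>. D (\<tau> n) \<omega> / real (Suc n)"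
    have "AE \<omega> in M. (\<lambda>n. ?Y n \<omega>) \<longlonglongrightarrow> 0"
      using class_C_2
    proof eventually_elim
      fix \<omega> assume "class_C 2 (f \<omega>)"
      then obtain g1 g2 where g: "\<And>t. ((\<lambda>t. f \<omega> (0 + t *\<^sub>R v)) has_real_derivative g1 t) (at t)"
        "\<And>t. (g1 has_real_derivative g2 t) (at t)" "continuous_on UNIV g2"
        using class_C_2_line by blast
      have "(\<lambda>n. D (\<tau> n) \<omega>) \<longlonglongrightarrow> g2 0"
        using second_difference_tendsto[OF g \<open>\<tau> \<longlonglongrightarrow> 0\<close> \<tau>(1)] by (simp add: D_def)
      then have "(\<lambda>n. D (\<tau> n) \<omega> * inverse (real (Suc n))) \<longlonglongrightarrow> g2 0 * 0"
        by (intro tendsto_intros LIMSEQ_inverse_real_of_nat)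
      then show "(\<lambda>n. ?Y n \<omega>) \<longlonglongrightarrow> 0"
        by (simp add: divide_inverse)
    qed
    then have "(\<lambda>n. expectation (\<lambda>\<omega>. (?Y n \<omega>)\<^sup>2)) \<longlonglongrightarrow> 0"
      unfolding D_def by (intro lincombs_AE_tendsto_0 lincombs_intros)
    moreover have "1 \<le> expectation (\<lambda>\<omega>. (?Y n \<omega>)\<^sup>2)" for n
      using large[of n] by (simp add: power_divide)
    ultimately have "(1::real) \<le> 0"
      by (intro LIMSEQ_le_const) auto
    then show False by simp
  qed
  moreover have "expectation (\<lambda>\<omega>. ((f \<omega> (x + (2 * \<tau>) *\<^sub>R v) - 2 * f \<omega> (x + \<tau> *\<^sub>R v) + f \<omega> x) / \<tau>\<^sup>2)\<^sup>2) =
      expectation (\<lambda>\<omega>. (D \<tau> \<omega>)\<^sup>2)" for x \<tau>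
    using second_difference_variance[of x \<tau> v 0] by (simp add: D_def)
  ultimately show ?thesis
    by simp
qed

end

section \<open>Two zeros on a segment\<close>

lemma abs_diff_le_sum_abs_increments:
  fixes a :: "nat \<Rightarrow> real"
  assumes "i \<le> n" "j \<le> n"
  shows "\<bar>a i - a j\<bar> \<le> (\<Sum>k<n. \<bar>a (Suc k) - a k\<bar>)"
proof -
  have *: "\<bar>a j - a i\<bar> \<le> (\<Sum>k<n. \<bar>a (Suc k) - a k\<bar>)" if "i \<le> j" "j \<le> n" for i j
  proof -
    have "\<bar>a j - a i\<bar> = \<bar>\<Sum>k=i..<j. a (Suc k) - a k\<bar>"
      using that by (simp add: sum_Suc_diff')
    also have "\<dots> \<le> (\<Sum>k=i..<j. \<bar>a (Suc k) - a k\<bar>)"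
      by (rule sum_abs)
    also have "\<dots> \<le> (\<Sum>k<n. \<bar>a (Suc k) - a k\<bar>)"
      using that by (intro sum_mono2) auto
    finally show ?thesis .
  qed
  show ?thesis
    using *[of i j] *[of j i] assms by (cases "i \<le> j") (auto simp: abs_minus_commute)
qed

text \<open>
  If the second differences of \<open>g\<close> average to at most \<open>u\<close> then all slopes of the grid differ by at
  most \<open>\<epsilon> u\<close>. By the mean value theorem one of the slopes is almost zero, hence all are small, and so is \<open>g 0\<close>.
\<close>

lemma two_zeros_grid:
  fixes g g1 :: "real \<Rightarrow> real"
  assumes g1: "\<And>t. (g has_real_derivative g1 t) (at t)" and cont: "continuous_on UNIV g1"
    and z: "0 \<le> z1" "z1 < z2" "z2 \<le> \<epsilon>" "g z1 = 0" "g z2 = 0" and u: "u > 0"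
  shows "\<forall>\<^sub>F n in sequentially.
    u < (\<Sum>k<n. \<bar>(g (real k * (\<epsilon> / n) + 2 * (\<epsilon> / n)) - 2 * g (real k * (\<epsilon> / n) + \<epsilon> / n)
            + g (real k * (\<epsilon> / n))) / (\<epsilon> / n)\<^sup>2\<bar>) / n \<or>
    (\<bar>g 0\<bar> \<le> 2 * \<epsilon>\<^sup>2 * u \<and> \<bar>(g (\<epsilon> / n) - g 0) / (\<epsilon> / n)\<bar> \<le> 2 * \<epsilon> * u)"
proof -
  have "\<epsilon> > 0" using z by linarith
  have contg: "isCont g t" for t
    using g1 DERIV_isCont by blast
  obtain \<xi> where \<xi>: "z1 < \<xi>" "\<xi> < z2" "g1 \<xi> = 0"
    using MVT2[of z1 z2 g g1] g1 z by force
  have "isCont g1 \<xi>"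
    using cont by (simp add: continuous_on_eq_continuous_at)
  \<comment> \<open>The two tolerances are the rounding errors of the grid. Half a unit on top of
    the oscillation \<epsilon> u bounds slopes by 3/2 \<epsilon> u; half a unit more for the value
    at the zero gives the constant 2.\<close>
  then obtain d where d: "d > 0" "\<And>t. \<bar>t - \<xi>\<bar> < d \<Longrightarrow> \<bar>g1 t\<bar> < \<epsilon> * u / 2"
    using \<open>\<epsilon> > 0\<close> u \<xi>(3) unfolding continuous_at_eps_delta dist_real_def
    by (elim allE[of _ "\<epsilon> * u / 2"]) auto
  obtain d' where d': "d' > 0" "\<And>t. \<bar>t - z1\<bar> < d' \<Longrightarrow> \<bar>g t\<bar> < \<epsilon>\<^sup>2 * u / 2"
    using \<open>\<epsilon> > 0\<close> u z contg[of z1] unfolding continuous_at_eps_delta dist_real_def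
    by (elim allE[of _ "\<epsilon>\<^sup>2 * u / 2"]) auto
  have "(\<lambda>n. \<epsilon> / real n) \<longlonglongrightarrow> 0"
    by (rule lim_const_over_n)
  then have "\<forall>\<^sub>F n in sequentially. \<epsilon> / real n < min d d'"
    using d d' by (intro order_tendstoD) auto
  moreover have "\<forall>\<^sub>F n in sequentially. n > (0::nat)"
    by (rule eventually_gt_at_top)
  ultimately show ?thesis
  proof eventually_elim
    case (elim n)
    define h where "h = \<epsilon> / real n"
    have h: "h > 0" "h < d" "h < d'" "real n * h = \<epsilon>"
      using elim \<open>\<epsilon> > 0\<close> by (auto simp: h_def)
    define D where "D k = (g (real (Suc k) * h) - g (real k * h)) / h" for k
    define Y where "Y = (\<Sum>k<n. \<bar>(g (real k * h + 2 * h) - 2 * g (real k * h + h) + g (real k * h)) / h\<^sup>2\<bar>) / n"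
    have "\<bar>g 0\<bar> \<le> 2 * \<epsilon>\<^sup>2 * u \<and> \<bar>(g h - g 0) / h\<bar> \<le> 2 * \<epsilon> * u" if "Y \<le> u"
    proof -
      \<comment> \<open>A second difference quotient is the increment of neighbouring slopes divided
        by h. The total variation of the slopes is therefore n h = \<epsilon> times the
        mean.\<close>
      have incr: "D (Suc k) - D k = h * ((g (real k * h + 2 * h) - 2 * g (real k * h + h) + g (real k * h)) / h\<^sup>2)" for k
        using h(1) by (simp add: D_def power2_eq_square diff_divide_distrib add_divide_distrib algebra_simps)
      have "(\<Sum>k<n. \<bar>D (Suc k) - D k\<bar>) = h * (real n * Y)"
      proof -
        have "real n * Y = (\<Sum>k<n. \<bar>(g (real k * h + 2 * h) - 2 * g (real k * h + h) + g (real k * h)) / h\<^sup>2\<bar>)"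
          using elim by (simp add: Y_def)
        then show ?thesis
          unfolding incr abs_mult using h(1) by (simp add: sum_distrib_left)
      qed
      also have "\<dots> \<le> \<epsilon> * u"
        using h \<open>Y \<le> u\<close> \<open>\<epsilon> > 0\<close> by (metis mult.assoc mult.commute mult_left_mono less_imp_le)
      \<comment> \<open>The index n is included: \<open>D n\<close> is the slope just beyond the
        segment, from \<epsilon> to \<epsilon> + h. This is why the last second difference also
        leaves the segment.\<close>
      finally have osc: "\<bar>D i - D j\<bar> \<le> \<epsilon> * u" if "i \<le> n" "j \<le> n" for i j
        using abs_diff_le_sum_abs_increments[OF that, of D] by linarith
      have grid: "real (nat \<lfloor>t / h\<rfloor>) * h \<le> t" "t < real (nat \<lfloor>t / h\<rfloor>) * h + h" "nat \<lfloor>t / h\<rfloor> \<le> n"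
        if "0 \<le> t" "t \<le> \<epsilon>" for t
      proof -
        have "0 \<le> t / h" using that h by simp
        then have fl: "real (nat \<lfloor>t / h\<rfloor>) \<le> t / h" "t / h < real (nat \<lfloor>t / h\<rfloor>) + 1"
          by (auto simp: le_nat_iff)
        then show *: "real (nat \<lfloor>t / h\<rfloor>) * h \<le> t" "t < real (nat \<lfloor>t / h\<rfloor>) * h + h"
          using h(1) by (auto simp: field_simps)
        have "real (nat \<lfloor>t / h\<rfloor>) * h \<le> real n * h" using * that h by linarith
        then show "nat \<lfloor>t / h\<rfloor> \<le> n" using h(1) by simp
      qed
      \<comment> \<open>The grid cell of the critical point \<xi>; its slope is a value of
        \<open>g1\<close> at distance less than d from \<xi>.\<close>
      define j where "j = nat \<lfloor>\<xi> / h\<rfloor>"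
      have j: "real j * h \<le> \<xi>" "\<xi> < real j * h + h" "j \<le> n"
        unfolding j_def by (rule grid; use \<xi> z in linarith)+
      have "\<bar>D j\<bar> < \<epsilon> * u / 2"
      proof -
        obtain \<theta> where \<theta>: "real j * h < \<theta>" "\<theta> < real (Suc j) * h"
          "g (real (Suc j) * h) - g (real j * h) = (real (Suc j) * h - real j * h) * g1 \<theta>"
          using MVT2[of "real j * h" "real (Suc j) * h" g g1] h(1) g1 by (auto simp: algebra_simps)
        then have "D j = g1 \<theta>"
          using h(1) by (simp add: D_def algebra_simps)
        moreover have "\<bar>\<theta> - \<xi>\<bar> < d"
          using \<theta> j h by (auto simp: algebra_simps)
        ultimately show ?thesis using d(2) by simp
      qed
      then have slope: "\<bar>D k\<bar> \<le> 3 / 2 * (\<epsilon> * u)" if "k \<le> n" for k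
        using osc[OF that j(3)] by linarith
      \<comment> \<open>The grid point to the left of the zero z1. The value there is small by
        continuity, and summing the slopes back to 0 changes it by at most 3/2 \<epsilon>^2
        u.\<close>
      define i where "i = nat \<lfloor>z1 / h\<rfloor>"
      have i: "real i * h \<le> z1" "z1 < real i * h + h" "i \<le> n"
        unfolding i_def by (rule grid; use z in linarith)+
      have "\<bar>g 0\<bar> \<le> 2 * \<epsilon>\<^sup>2 * u"
      proof -
        have "(\<Sum>k<i. h * D k) = g (real i * h) - g 0"
          using sum_lessThan_telescope[of "\<lambda>k. g (real k * h)" i] h(1) by (simp add: D_def)
        moreover have "\<bar>\<Sum>k<i. h * D k\<bar> \<le> (\<Sum>k<i. h * (3 / 2 * (\<epsilon> * u)))"
          using slope i(3) h(1)
          by (intro order_trans[OF sum_abs] sum_mono) (auto simp: abs_mult intro!: mult_left_mono)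
        moreover have "(\<Sum>k<i. h * (3 / 2 * (\<epsilon> * u))) \<le> \<epsilon> * (3 / 2 * (\<epsilon> * u))"
        proof -
          have "(real i * h) * (3 / 2 * (\<epsilon> * u)) \<le> \<epsilon> * (3 / 2 * (\<epsilon> * u))"
            using i z u \<open>\<epsilon> > 0\<close> by (intro mult_right_mono) auto
          then show ?thesis by (simp add: mult.assoc)
        qed
        moreover have "\<bar>g (real i * h)\<bar> < \<epsilon>\<^sup>2 * u / 2"
          using i h by (intro d') auto
        moreover have "\<epsilon> * (3 / 2 * (\<epsilon> * u)) = 3 / 2 * (\<epsilon>\<^sup>2 * u)"
          by (simp add: power2_eq_square)
        moreover have "2 * \<epsilon>\<^sup>2 * u = 2 * (\<epsilon>\<^sup>2 * u)" by simp
        ultimately show ?thesis by linarith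
      qed
      moreover have "\<bar>(g h - g 0) / h\<bar> \<le> 2 * \<epsilon> * u"
      proof -
        have "\<bar>(g h - g 0) / h\<bar> \<le> 3 / 2 * (\<epsilon> * u)"
          using slope[of 0] by (simp add: D_def)
        also have "\<dots> \<le> 2 * \<epsilon> * u" using \<open>\<epsilon> > 0\<close> u by simp
        finally show ?thesis .
      qed
      ultimately show ?thesis ..
    qed
    then show ?case
      unfolding Y_def h_def by linarith
  qed
qed

text \<open>Jensen's inequality. It reduces moments of the mean second difference to moments of
  single ones, whatever their dependence.\<close>

lemma power_mean_le:
  fixes a :: "nat \<Rightarrow> real"
  assumes "even m" "n > 0"
  shows "((\<Sum>k<n. a k) / n) ^ m \<le> (\<Sum>k<n. a k ^ m) / n"
proof -
  have "(\<Sum>k<n. (1 / real n) *\<^sub>R a k) ^ m \<le> (\<Sum>k<n. (1 / real n) * a k ^ m)"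
    using assms by (intro convex_on_sum[OF _ _ convex_power_even]) auto
  then show ?thesis
    by (simp add: sum_divide_distrib)
qed

text \<open>The grid detects two zeros only for n beyond a threshold that depends on the sample. The
  event that detection eventually holds still inherits the bound, as an increasing union of
  intersections.\<close>

lemma (in prob_space) prob_liminf_le:
  fixes A :: "nat \<Rightarrow> 'a set"
  assumes A: "\<And>n. A n \<in> events" and b: "\<And>n. n > 0 \<Longrightarrow> prob (A n) \<le> b"
  shows "prob (\<Union>N. \<Inter>n\<in>{N..}. A n) \<le> b"
proof -
  let ?B = "\<lambda>N. \<Inter>n\<in>{N..}. A n"
  have B: "?B N \<in> events" for N
    using A by (intro sets.countable_INT') auto
  have "incseq ?B"
    by (intro incseq_SucI INF_superset_mono) auto
  then have "(\<lambda>N. prob (?B N)) \<longlonglongrightarrow> prob (\<Union>N. ?B N)"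
    using B by (intro finite_Lim_measure_incseq) auto
  moreover have "prob (?B N) \<le> b" for N
  proof -
    have "prob (?B N) \<le> prob (A (Suc N))"
      using A by (intro finite_measure_mono) auto
    also have "\<dots> \<le> b" by (rule b) simp
    finally show ?thesis .
  qed
  ultimately show ?thesis
    by (intro LIMSEQ_le_const2[of "\<lambda>N. prob (?B N)"]) auto
qed

section \<open>Probability of two zeros on one segment\<close>

context smooth_gaussian_field
begin

text \<open>With d = b / h and \<psi> the variance of the increment, the quadratic form is a^2 - a d
  \<psi> + d^2 \<psi>. Since \<psi> <= 1, the cross term is at most half of a^2 + d^2 \<psi>, and
  \<open>lower\<close> turns d^2 \<psi> into at least c b^2. The bound does not deteriorate as h
  tends to 0.\<close>

lemma value_slope_small_ball:
  assumes c: "c > 0" and h: "h > 0" and lower: "c * h\<^sup>2 \<le> 2 * (K 0 - K (h *\<^sub>R v))"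
    and upper: "2 * (K 0 - K (h *\<^sub>R v)) \<le> 1" and pos: "\<alpha> > 0" "\<beta> > 0"
  shows "prob {\<omega> \<in> space M. \<bar>f \<omega> x\<bar> \<le> \<alpha> \<and> \<bar>(f \<omega> (x + h *\<^sub>R v) - f \<omega> x) / h\<bar> \<le> \<beta>}
    \<le> 2 * exp 1 * \<alpha> * \<beta> / sqrt c"
proof -
  define \<psi> where "\<psi> = 2 * (K 0 - K (h *\<^sub>R v))"
  define Q where "Q a b = expectation (\<lambda>\<omega>. (a * f \<omega> x + b * ((f \<omega> (x + h *\<^sub>R v) - f \<omega> x) / h))\<^sup>2)" for a b
  have Q: "1 / 2 * a\<^sup>2 + c / 2 * b\<^sup>2 \<le> Q a b" for a b
  proof -
    define d where "d = b / h"
    have "0 \<le> c * h\<^sup>2" using c by simp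
    then have \<psi>: "0 \<le> \<psi>" "\<psi> \<le> 1" "c * h\<^sup>2 \<le> \<psi>"
      using lower upper by (auto simp: \<psi>_def)
    have "Q a b = expectation (\<lambda>\<omega>. (\<Sum>i\<in>{True, False}. (if i then a - d else d) *
        f \<omega> (if i then x else x + h *\<^sub>R v))\<^sup>2)"
      by (simp add: Q_def d_def algebra_simps diff_divide_distrib)
    also have "\<dots> = (a - d) * (a - d) + d * d + 2 * ((a - d) * d * K (h *\<^sub>R v))"
      by (subst expectation_lincomb_square)
        (simp_all add: normalized covariance_minus)
    also have "\<dots> = a\<^sup>2 - a * d * \<psi> + d\<^sup>2 * \<psi>"
      unfolding \<psi>_def normalized by (simp add: algebra_simps power2_eq_square)
    finally have Qeq: "Q a b = a\<^sup>2 - a * d * \<psi> + d\<^sup>2 * \<psi>" .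
    have "2 * (a * (d * \<psi>)) \<le> a\<^sup>2 + (d * \<psi>)\<^sup>2"
      using sum_squares_bound[of a "d * \<psi>"] by (simp add: mult.assoc)
    moreover have "(d * \<psi>)\<^sup>2 \<le> d\<^sup>2 * \<psi>"
    proof -
      have "\<psi>\<^sup>2 \<le> \<psi>" using \<psi> by (simp add: power2_eq_square mult_left_le)
      then show ?thesis by (simp add: power_mult_distrib mult_left_mono)
    qed
    moreover have "c * b\<^sup>2 \<le> d\<^sup>2 * \<psi>"
    proof -
      have "c * b\<^sup>2 = d\<^sup>2 * (c * h\<^sup>2)" using h by (simp add: d_def power_divide)
      also have "\<dots> \<le> d\<^sup>2 * \<psi>" using \<psi> by (intro mult_left_mono) auto
      finally show ?thesis .
    qed
    ultimately show ?thesis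
      unfolding Qeq by (simp add: algebra_simps)
  qed
  have "prob {\<omega> \<in> space M. \<bar>f \<omega> x\<bar> \<le> \<alpha> \<and> \<bar>(f \<omega> (x + h *\<^sub>R v) - f \<omega> x) / h\<bar> \<le> \<beta>}
    \<le> exp 1 * \<alpha> * \<beta> / sqrt (1 / 2 * (c / 2))"
  proof (rule gaussian_small_ball[where Q = Q])
    show "(CLINT \<omega>|M. iexp (a * f \<omega> x + b * ((f \<omega> (x + h *\<^sub>R v) - f \<omega> x) / h))) =
        complex_of_real (exp (- Q a b / 2))" for a b
      unfolding Q_def by (intro lincombs_char lincombs_intros)
  qed (use Q c pos in auto)
  also have "\<dots> = 2 * exp 1 * \<alpha> * \<beta> / sqrt c"
    by (simp add: real_sqrt_divide)
  finally show ?thesis .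
qed

text \<open>Markov's inequality for the power 2m of the mean. Only the law of each single term
  enters, so the bound depends neither on n nor on the points \<open>y k\<close>, and the mesh can
  be refined freely.\<close>

lemma mean_second_difference_tail:
  fixes n m :: nat
  assumes C: "\<And>x. expectation (\<lambda>\<omega>. ((f \<omega> (x + (2 * h) *\<^sub>R v) - 2 * f \<omega> (x + h *\<^sub>R v) + f \<omega> x) / h\<^sup>2)\<^sup>2) \<le> C"
    and u: "u > 0" and n: "n > 0"
  shows "prob {\<omega> \<in> space M. u < (\<Sum>k<n. \<bar>(f \<omega> (y k + (2 * h) *\<^sub>R v) - 2 * f \<omega> (y k + h *\<^sub>R v) + f \<omega> (y k)) / h\<^sup>2\<bar>) / n}
    \<le> fact (2 * m) / (2 ^ m * fact m) * C ^ m / u ^ (2 * m)"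
proof -
  define D where "D k \<omega> = (f \<omega> (y k + (2 * h) *\<^sub>R v) - 2 * f \<omega> (y k + h *\<^sub>R v) + f \<omega> (y k)) / h\<^sup>2" for k \<omega>
  let ?\<kappa> = "fact (2 * m) / (2 ^ m * fact m) :: real"
  have "D k \<in> lincombs" for k
    unfolding D_def[abs_def] by (intro lincombs_intros)
  note D = lincombs_centered_normal[OF this] lincombs_measurable[OF this]
  note [measurable] = D(2)
  have moment: "expectation (\<lambda>\<omega>. D k \<omega> ^ (2 * m)) \<le> ?\<kappa> * C ^ m" for k
    unfolding centered_normal_moments(2)[OF D(1)]
    by (intro mult_left_mono power_mono) (simp_all add: D_def C)
  have int: "integrable M (\<lambda>\<omega>. (\<Sum>k<n. D k \<omega> ^ (2 * m)) / n)"
    using centered_normal_moments(1)[OF D(1)] by (intro integrable_divide Bochner_Integration.integrable_sum) auto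
  have "prob {\<omega> \<in> space M. u < (\<Sum>k<n. \<bar>D k \<omega>\<bar>) / n} \<le>
      prob {\<omega> \<in> space M. (\<Sum>k<n. D k \<omega> ^ (2 * m)) / n \<ge> u ^ (2 * m)}"
  proof (rule finite_measure_mono)
    show "{\<omega> \<in> space M. u < (\<Sum>k<n. \<bar>D k \<omega>\<bar>) / n} \<subseteq>
        {\<omega> \<in> space M. (\<Sum>k<n. D k \<omega> ^ (2 * m)) / n \<ge> u ^ (2 * m)}"
    proof safe
      fix \<omega> assume "u < (\<Sum>k<n. \<bar>D k \<omega>\<bar>) / n"
      then have "u ^ (2 * m) \<le> ((\<Sum>k<n. \<bar>D k \<omega>\<bar>) / n) ^ (2 * m)"
        using u by (intro power_mono) auto
      also have "\<dots> \<le> (\<Sum>k<n. \<bar>D k \<omega>\<bar> ^ (2 * m)) / n"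
        using n by (intro power_mean_le) auto
      finally show "(\<Sum>k<n. D k \<omega> ^ (2 * m)) / n \<ge> u ^ (2 * m)"
        by (simp add: power_mult)
    qed
  qed measurable
  also have "\<dots> \<le> expectation (\<lambda>\<omega>. (\<Sum>k<n. D k \<omega> ^ (2 * m)) / n) / u ^ (2 * m)"
    using u by (intro integral_Markov_inequality_measure[OF int, of "{}"])
      (auto intro!: AE_I2 divide_nonneg_nonneg sum_nonneg simp: power_mult)
  also have "expectation (\<lambda>\<omega>. (\<Sum>k<n. D k \<omega> ^ (2 * m)) / n) =
      (\<Sum>k<n. expectation (\<lambda>\<omega>. D k \<omega> ^ (2 * m))) / n"
    using centered_normal_moments(1)[OF D(1)] by simp
  also have "\<dots> / u ^ (2 * m) \<le> ?\<kappa> * C ^ m / u ^ (2 * m)"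
  proof (rule divide_right_mono)
    have "(\<Sum>k<n. expectation (\<lambda>\<omega>. D k \<omega> ^ (2 * m))) \<le> real n * (?\<kappa> * C ^ m)"
      using sum_mono[of "{..<n}", OF moment] by simp
    then show "(\<Sum>k<n. expectation (\<lambda>\<omega>. D k \<omega> ^ (2 * m))) / n \<le> ?\<kappa> * C ^ m"
      using n by (simp add: field_simps)
  qed (use u in simp)
  finally show ?thesis
    unfolding D_def .
qed

text \<open>Parametrizing the length as q^4 avoids fractional powers. A measurable superset
  \<open>B\<close> is asserted because the event of two zeros is itself not yet known to be
  measurable, and smoothness is a condition on the sample because it holds only almost
  surely.\<close>

lemma segment_two_zeros_bound:
  assumes "v \<noteq> 0"
  shows "\<exists>C\<ge>0. \<exists>q\<^sub>0>0. \<forall>x q. 0 < q \<and> q < q\<^sub>0 \<longrightarrow> (\<exists>B\<in>events. prob B \<le> C * q ^ 10 \<and>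
    (\<forall>\<omega>\<in>space M. \<forall>z1 z2. class_C 2 (f \<omega>) \<and> 0 \<le> z1 \<and> z1 < z2 \<and> z2 \<le> q ^ 4 \<and>
       f \<omega> (x + z1 *\<^sub>R v) = 0 \<and> f \<omega> (x + z2 *\<^sub>R v) = 0 \<longrightarrow> \<omega> \<in> B))"
proof -
  obtain c \<tau>1 where c: "c > 0" and "\<tau>1 > 0"
    and lower: "\<And>\<tau>. 0 < \<tau> \<Longrightarrow> \<tau> < \<tau>1 \<Longrightarrow> c * \<tau>\<^sup>2 \<le> 2 * (K 0 - K (\<tau> *\<^sub>R v))"
    using increment_variance_lower_bound[OF assms] by blast
  obtain C \<tau>2 where "C \<ge> 0" and "\<tau>2 > 0"
    and second: "\<And>x \<tau>. 0 < \<tau> \<Longrightarrow> \<tau> < \<tau>2 \<Longrightarrow>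
      expectation (\<lambda>\<omega>. ((f \<omega> (x + (2 * \<tau>) *\<^sub>R v) - 2 * f \<omega> (x + \<tau> *\<^sub>R v) + f \<omega> x) / \<tau>\<^sup>2)\<^sup>2) \<le> C"
    using second_difference_variance_bound[of v] by blast
  have "((\<lambda>\<tau>. 2 * (K 0 - K (\<tau> *\<^sub>R v))) \<longlongrightarrow> 2 * (K 0 - K (0 *\<^sub>R v))) (at 0)"
    by (intro tendsto_intros isCont_tendsto_compose[OF covariance_continuous])
  then have "\<forall>\<^sub>F \<tau> in at 0. 2 * (K 0 - K (\<tau> *\<^sub>R v)) < 1"
    by (intro order_tendstoD) auto
  then obtain \<tau>3 where "\<tau>3 > 0" and "\<And>\<tau>. \<tau> \<noteq> 0 \<Longrightarrow> \<bar>\<tau>\<bar> < \<tau>3 \<Longrightarrow> 2 * (K 0 - K (\<tau> *\<^sub>R v)) < 1"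
    unfolding eventually_at dist_real_def by auto
  then have upper: "2 * (K 0 - K (\<tau> *\<^sub>R v)) \<le> 1" if "0 < \<tau>" "\<tau> < \<tau>3" for \<tau>
    using that by (simp add: less_imp_le)
  define q0 where "q0 = min 1 (min \<tau>1 (min \<tau>2 \<tau>3))"
  have "q0 > 0"
    using \<open>\<tau>1 > 0\<close> \<open>\<tau>2 > 0\<close> \<open>\<tau>3 > 0\<close> by (simp add: q0_def)
  \<comment> \<open>The first summand is the normal moment of order 12; the second is the small ball
    bound with radii 2 \<epsilon>^2 u and 2 \<epsilon> u, whence 8 = 2 * 2 * 2.\<close>
  define C' :: real where "C' = fact (2 * 6) / (2 ^ 6 * fact 6) * C ^ 6 + 8 * exp 1 / sqrt c"
  have "C' \<ge> 0"
    using \<open>C \<ge> 0\<close> c by (simp add: C'_def)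
  have "\<exists>B\<in>events. prob B \<le> C' * q ^ 10 \<and>
    (\<forall>\<omega>\<in>space M. \<forall>z1 z2. class_C 2 (f \<omega>) \<and> 0 \<le> z1 \<and> z1 < z2 \<and> z2 \<le> q ^ 4 \<and>
       f \<omega> (x + z1 *\<^sub>R v) = 0 \<and> f \<omega> (x + z2 *\<^sub>R v) = 0 \<longrightarrow> \<omega> \<in> B)"
    if q: "0 < q" "q < q0" for x q
  proof -
    define \<epsilon> u where "\<epsilon> = q ^ 4" and "u = 1 / q"
    have "q < 1" using q by (simp add: q0_def)
    have "\<epsilon> > 0" "u > 0" using q by (auto simp: \<epsilon>_def u_def)
    define h where "h n = \<epsilon> / real n" for n :: nat
    have h: "0 < h n" "h n < q0" if "n > 0" for n
    proof -
      show "0 < h n" using that \<open>\<epsilon> > 0\<close> by (simp add: h_def)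
      have "h n \<le> \<epsilon>" using that \<open>\<epsilon> > 0\<close> by (simp add: h_def divide_le_eq mult_le_cancel_left1)
      also have "\<epsilon> \<le> q" using q \<open>q < 1\<close> power_decreasing[of 1 4 q] by (simp add: \<epsilon>_def)
      finally show "h n < q0" using q by simp
    qed
    define y where "y n k = x + (real k * h n) *\<^sub>R v" for n k :: nat
    define A1 where "A1 n = {\<omega> \<in> space M. u < (\<Sum>k<n. \<bar>(f \<omega> (y n k + (2 * h n) *\<^sub>R v)
        - 2 * f \<omega> (y n k + h n *\<^sub>R v) + f \<omega> (y n k)) / (h n)\<^sup>2\<bar>) / n}" for n
    define A2 where "A2 n = {\<omega> \<in> space M. \<bar>f \<omega> x\<bar> \<le> 2 * \<epsilon>\<^sup>2 * u \<and>
        \<bar>(f \<omega> (x + h n *\<^sub>R v) - f \<omega> x) / h n\<bar> \<le> 2 * \<epsilon> * u}" for n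
    have [measurable]: "A1 n \<in> events" "A2 n \<in> events" for n
      unfolding A1_def A2_def by measurable
    have prob_A: "prob (A1 n \<union> A2 n) \<le> C' * q ^ 10" if "n > 0" for n
    proof -
      have "prob (A1 n) \<le> fact (2 * 6) / (2 ^ 6 * fact 6) * C ^ 6 / u ^ (2 * 6)"
        unfolding A1_def using h[OF that] \<open>u > 0\<close> that
        by (intro mean_second_difference_tail second) (auto simp: q0_def)
      also have "\<dots> = fact (2 * 6) / (2 ^ 6 * fact 6) * C ^ 6 * q ^ 12"
        by (simp add: u_def power_divide)
      also have "\<dots> \<le> fact (2 * 6) / (2 ^ 6 * fact 6) * C ^ 6 * q ^ 10"
        using \<open>C \<ge> 0\<close> q \<open>q < 1\<close> by (intro mult_left_mono power_decreasing) auto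
      finally have 1: "prob (A1 n) \<le> fact (2 * 6) / (2 ^ 6 * fact 6) * C ^ 6 * q ^ 10" .
      have "prob (A2 n) \<le> 2 * exp 1 * (2 * \<epsilon>\<^sup>2 * u) * (2 * \<epsilon> * u) / sqrt c"
        unfolding A2_def using h[OF that] \<open>u > 0\<close> \<open>\<epsilon> > 0\<close> c lower upper
        by (intro value_slope_small_ball) (auto simp: q0_def)
      also have "\<dots> = 8 * exp 1 / sqrt c * (\<epsilon> ^ 3 * u\<^sup>2)"
        by (simp add: power2_eq_square power3_eq_cube)
      also have "\<epsilon> ^ 3 * u\<^sup>2 = q ^ 10"
        using q by (simp add: \<epsilon>_def u_def power_divide power_mult[symmetric] field_simps power_add[symmetric])
      finally have 2: "prob (A2 n) \<le> 8 * exp 1 / sqrt c * q ^ 10" .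
      have "prob (A1 n \<union> A2 n) \<le> prob (A1 n) + prob (A2 n)"
        by (intro measure_Un_le) auto
      with 1 2 show ?thesis
        by (simp only: C'_def distrib_right)
    qed
    \<comment> \<open>The lower limit of the grid events: it contains every smooth sample with two
      zeros, although the mesh from which the alternative holds varies with the sample.\<close>
    let ?B = "\<Union>N. \<Inter>n\<in>{N..}. A1 n \<union> A2 n"
    have "?B \<in> events"
      by (intro sets.countable_UN sets.countable_INT' subsetI) auto
    moreover have "prob ?B \<le> C' * q ^ 10"
      using prob_A by (intro prob_liminf_le) auto
    moreover have "\<omega> \<in> ?B"
      if \<omega>: "\<omega> \<in> space M" "class_C 2 (f \<omega>)" and z: "0 \<le> z1" "z1 < z2" "z2 \<le> q ^ 4"
        "f \<omega> (x + z1 *\<^sub>R v) = 0" "f \<omega> (x + z2 *\<^sub>R v) = 0" for \<omega> z1 z2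
    proof -
      obtain g1 g2 where g: "\<And>t. ((\<lambda>t. f \<omega> (x + t *\<^sub>R v)) has_real_derivative g1 t) (at t)"
        "\<And>t. (g1 has_real_derivative g2 t) (at t)"
        by (rule class_C_2_line[OF \<omega>(2), of x v]) blast
      have "continuous_on UNIV g1"
        using g(2) DERIV_isCont by (blast intro: continuous_at_imp_continuous_on)
      note grid = two_zeros_grid[OF g(1) this z(1,2) z(3)[folded \<epsilon>_def] z(4,5) \<open>u > 0\<close>]
      have "\<forall>\<^sub>F n in sequentially. \<omega> \<in> A1 n \<union> A2 n"
        using grid by eventually_elim
          (use \<omega>(1) in \<open>simp add: A1_def A2_def y_def h_def scaleR_left_distrib add.assoc\<close>)
      then show ?thesis
        by (auto simp: eventually_sequentially)
    qed
    ultimately show ?thesis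
      by (intro bexI[of _ ?B]) auto
  qed
  then show ?thesis
    by (intro exI[of _ C'] exI[of _ q0] conjI allI impI \<open>C' \<ge> 0\<close> \<open>q0 > 0\<close>) (elim conjE)
qed

end

text \<open>By compactness a zero exists iff |g| has infimum 0, and by density rational points
  suffice for the infimum. This describes zeros by countably many fixed evaluations. The strict
  inequality a < b matters: a single irrational point contains no rational.\<close>

lemma zero_in_interval_iff_rational:
  fixes g :: "real \<Rightarrow> real"
  assumes cont: "continuous_on UNIV g" and "a < b"
  shows "(\<exists>z\<in>{a..b}. g z = 0) \<longleftrightarrow> (\<forall>n. \<exists>t\<in>{a..b} \<inter> \<rat>. \<bar>g t\<bar> < inverse (real (Suc n)))"
proof
  assume "\<exists>z\<in>{a..b}. g z = 0"
  then obtain z where z: "a \<le> z" "z \<le> b" "g z = 0" by auto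
  show "\<forall>n. \<exists>t\<in>{a..b} \<inter> \<rat>. \<bar>g t\<bar> < inverse (real (Suc n))"
  proof
    fix n
    have "isCont g z"
      using cont by (simp add: continuous_on_eq_continuous_at)
    moreover have "inverse (real (Suc n)) > 0" by simp
    ultimately obtain d where "d > 0" and d: "\<And>t. \<bar>t - z\<bar> < d \<Longrightarrow> \<bar>g t\<bar> < inverse (real (Suc n))"
      using z(3) unfolding continuous_at_eps_delta dist_real_def
      by (elim allE[of _ "inverse (real (Suc n))"]) auto
    have "max a (z - d) < min b (z + d)"
      using z \<open>a < b\<close> \<open>d > 0\<close> by auto
    then obtain t where "t \<in> \<rat>" "max a (z - d) < t" "t < min b (z + d)"
      using Rats_dense_in_real by blast
    then show "\<exists>t\<in>{a..b} \<inter> \<rat>. \<bar>g t\<bar> < inverse (real (Suc n))"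
      by (intro bexI[of _ t] d) auto
  qed
next
  assume rat: "\<forall>n. \<exists>t\<in>{a..b} \<inter> \<rat>. \<bar>g t\<bar> < inverse (real (Suc n))"
  have "continuous_on {a..b} (\<lambda>t. \<bar>g t\<bar>)"
    using cont continuous_on_subset by (intro continuous_on_rabs) blast
  then obtain z where z: "z \<in> {a..b}" "\<And>t. t \<in> {a..b} \<Longrightarrow> \<bar>g z\<bar> \<le> \<bar>g t\<bar>"
    using continuous_attains_inf[of "{a..b}" "\<lambda>t. \<bar>g t\<bar>"] \<open>a < b\<close> by auto
  have "g z = 0"
  proof (rule ccontr)
    assume "g z \<noteq> 0"
    then obtain n where "inverse (real (Suc n)) < \<bar>g z\<bar>"
      using reals_Archimedean[of "\<bar>g z\<bar>"] by auto
    moreover obtain t where "t \<in> {a..b}" "\<bar>g t\<bar> < inverse (real (Suc n))"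
      using rat by blast
    ultimately show False
      using z(2)[of t] by simp
  qed
  with z show "\<exists>z\<in>{a..b}. g z = 0" by blast
qed

text \<open>Distinct zeros are separated by a rational gap, leaving one zero in [0, p] and one in
  [q, \<epsilon>]. The conditions 0 < p and q < \<epsilon> keep both intervals
  non-degenerate.\<close>

lemma two_zeros_iff_rational:
  fixes g :: "real \<Rightarrow> real"
  assumes "continuous_on UNIV g"
  shows "(\<exists>z1 z2. 0 \<le> z1 \<and> z1 < z2 \<and> z2 \<le> \<epsilon> \<and> g z1 = 0 \<and> g z2 = 0) \<longleftrightarrow>
    (\<exists>p\<in>\<rat>. \<exists>q\<in>\<rat>. 0 < p \<and> p < q \<and> q < \<epsilon> \<and>
      (\<forall>n. \<exists>t\<in>{0..p} \<inter> \<rat>. \<bar>g t\<bar> < inverse (real (Suc n))) \<and>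
      (\<forall>n. \<exists>t\<in>{q..\<epsilon>} \<inter> \<rat>. \<bar>g t\<bar> < inverse (real (Suc n))))"
proof
  assume "\<exists>z1 z2. 0 \<le> z1 \<and> z1 < z2 \<and> z2 \<le> \<epsilon> \<and> g z1 = 0 \<and> g z2 = 0"
  then obtain z1 z2 where z: "0 \<le> z1" "z1 < z2" "z2 \<le> \<epsilon>" "g z1 = 0" "g z2 = 0" by blast
  obtain p where p: "p \<in> \<rat>" "z1 < p" "p < z2"
    using Rats_dense_in_real[OF z(2)] by auto
  obtain q where q: "q \<in> \<rat>" "p < q" "q < z2"
    using Rats_dense_in_real[OF p(3)] by auto
  have "\<exists>z\<in>{0..p}. g z = 0" "\<exists>z\<in>{q..\<epsilon>}. g z = 0"
    using z p q by (auto intro: less_imp_le)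
  then show "\<exists>p\<in>\<rat>. \<exists>q\<in>\<rat>. 0 < p \<and> p < q \<and> q < \<epsilon> \<and>
      (\<forall>n. \<exists>t\<in>{0..p} \<inter> \<rat>. \<bar>g t\<bar> < inverse (real (Suc n))) \<and>
      (\<forall>n. \<exists>t\<in>{q..\<epsilon>} \<inter> \<rat>. \<bar>g t\<bar> < inverse (real (Suc n)))"
    using z p q by (intro bexI[OF _ p(1)] bexI[OF _ q(1)] conjI
        iffD1[OF zero_in_interval_iff_rational[OF assms]]) auto
next
  assume "\<exists>p\<in>\<rat>. \<exists>q\<in>\<rat>. 0 < p \<and> p < q \<and> q < \<epsilon> \<and>
      (\<forall>n. \<exists>t\<in>{0..p} \<inter> \<rat>. \<bar>g t\<bar> < inverse (real (Suc n))) \<and>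
      (\<forall>n. \<exists>t\<in>{q..\<epsilon>} \<inter> \<rat>. \<bar>g t\<bar> < inverse (real (Suc n)))"
  then obtain p q where pq: "0 < p" "p < q" "q < \<epsilon>"
    and zeros: "\<forall>n. \<exists>t\<in>{0..p} \<inter> \<rat>. \<bar>g t\<bar> < inverse (real (Suc n))"
      "\<forall>n. \<exists>t\<in>{q..\<epsilon>} \<inter> \<rat>. \<bar>g t\<bar> < inverse (real (Suc n))"
    by blast
  have "\<exists>z\<in>{0..p}. g z = 0" "\<exists>z\<in>{q..\<epsilon>}. g z = 0"
    using zeros unfolding zero_in_interval_iff_rational[OF assms pq(1)]
      zero_in_interval_iff_rational[OF assms pq(3)] .
  then obtain z1 z2 where "z1 \<in> {0..p}" "g z1 = 0" "z2 \<in> {q..\<epsilon>}" "g z2 = 0" by blast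
  then show "\<exists>z1 z2. 0 \<le> z1 \<and> z1 < z2 \<and> z2 \<le> \<epsilon> \<and> g z1 = 0 \<and> g z2 = 0"
    using pq by (intro exI[of _ z1] exI[of _ z2]) auto
qed

lemma closed_segment_line: "closed_segment x (x + \<epsilon> *\<^sub>R v) = (\<lambda>t. x + t *\<^sub>R v) ` {0..\<epsilon>}"
  if "\<epsilon> > 0" for x v :: "'a::real_vector"
proof -
  have "closed_segment x (x + \<epsilon> *\<^sub>R v) = (\<lambda>u. x + (\<epsilon> * u) *\<^sub>R v) ` {0..1}"
    by (auto simp: closed_segment_def algebra_simps intro!: image_eqI)
  also have "\<dots> = (\<lambda>t. x + t *\<^sub>R v) ` ((*) \<epsilon> ` {0..1})"
    by (simp add: image_image)
  also have "(*) \<epsilon> ` {0..1} = {0..\<epsilon>}"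
    using image_mult_atLeastAtMost[OF that, of 0 1] by simp
  finally show ?thesis .
qed

lemma finite_card_le_1_iff: "finite S \<and> card S \<le> 1 \<longleftrightarrow> (\<forall>a\<in>S. \<forall>b\<in>S. a = b)"
proof
  assume "\<forall>a\<in>S. \<forall>b\<in>S. a = b"
  then have "S = {} \<or> (\<exists>a. S = {a})" by blast
  then show "finite S \<and> card S \<le> 1" by auto
qed (auto simp: card_le_Suc0_iff_eq)

lemma segment_zeros_le_1_iff:
  assumes "\<epsilon> > 0" and "v \<noteq> 0"
  shows "finite (closed_segment x (x + \<epsilon> *\<^sub>R v) \<inter> g -` {0}) \<and>
      card (closed_segment x (x + \<epsilon> *\<^sub>R v) \<inter> g -` {0}) \<le> 1 \<longleftrightarrow>
    \<not> (\<exists>z1 z2. 0 \<le> z1 \<and> z1 < z2 \<and> z2 \<le> \<epsilon> \<and> g (x + z1 *\<^sub>R v) = 0 \<and> g (x + z2 *\<^sub>R v) = 0)"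
  (is "_ \<longleftrightarrow> \<not> ?two")
proof -
  let ?S = "closed_segment x (x + \<epsilon> *\<^sub>R v) \<inter> g -` {0}"
  have mem: "a \<in> ?S \<longleftrightarrow> (\<exists>z. 0 \<le> z \<and> z \<le> \<epsilon> \<and> a = x + z *\<^sub>R v \<and> g a = 0)" for a
    unfolding closed_segment_line[OF assms(1)] by auto
  have "(\<forall>a\<in>?S. \<forall>b\<in>?S. a = b) \<longleftrightarrow> \<not> ?two"
  proof
    assume eq: "\<forall>a\<in>?S. \<forall>b\<in>?S. a = b"
    show "\<not> ?two"
    proof
      assume ?two
      then obtain z1 z2 where z: "0 \<le> z1" "z1 < z2" "z2 \<le> \<epsilon>"
        "g (x + z1 *\<^sub>R v) = 0" "g (x + z2 *\<^sub>R v) = 0" by blast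
      have "x + z1 *\<^sub>R v \<in> ?S" "x + z2 *\<^sub>R v \<in> ?S"
        unfolding mem using z by (intro exI[of _ z1], simp) (use z in \<open>intro exI[of _ z2], simp\<close>)
      with eq have "x + z1 *\<^sub>R v = x + z2 *\<^sub>R v" by blast
      then show False using z(2) assms(2) by simp
    qed
  next
    assume not_two: "\<not> ?two"
    show "\<forall>a\<in>?S. \<forall>b\<in>?S. a = b"
    proof (intro ballI)
      fix a b assume "a \<in> ?S" "b \<in> ?S"
      then obtain z1 z2 where "0 \<le> z1" "z1 \<le> \<epsilon>" "a = x + z1 *\<^sub>R v" "g a = 0"
        "0 \<le> z2" "z2 \<le> \<epsilon>" "b = x + z2 *\<^sub>R v" "g b = 0"
        unfolding mem by blast
      then show "a = b"
        using not_two by (cases z1 z2 rule: linorder_cases) auto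
    qed
  qed
  then show ?thesis
    unfolding finite_card_le_1_iff .
qed

section \<open>Edges of a periodic lattice\<close>

lemma norm_le_of_mem_square: "x \<in> square s \<Longrightarrow> norm x \<le> 2 * s"
proof -
  assume "x \<in> square s"
  then have "\<bar>x $ 1\<bar> \<le> s" "\<bar>x $ 2\<bar> \<le> s" by (auto simp: square_def abs_le_iff minus_le_iff)
  then show ?thesis
    using norm_le_l1_cart[of x] by (simp add: sum_2)
qed

text \<open>The lower bounds serve to count the translates that reach a given square; the
  coordinates serve to move an edge near the origin.\<close>

lemma independent_pair_coordinates:
  fixes u w :: "real^2"
  assumes "u \<noteq> w" "independent {u, w}"
  obtains c where "c > 0" "\<And>\<alpha> \<beta>. c * \<bar>\<alpha>\<bar> \<le> norm (\<alpha> *\<^sub>R u + \<beta> *\<^sub>R w)"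
    "\<And>\<alpha> \<beta>. c * \<bar>\<beta>\<bar> \<le> norm (\<alpha> *\<^sub>R u + \<beta> *\<^sub>R w)" "\<And>x. \<exists>\<alpha> \<beta>. x = \<alpha> *\<^sub>R u + \<beta> *\<^sub>R w"
proof -
  let ?L = "\<lambda>p :: real \<times> real. fst p *\<^sub>R u + snd p *\<^sub>R w"
  have lin: "linear ?L"
    by (intro linearI) (auto simp: algebra_simps)
  have "u \<notin> span {w}" "w \<noteq> 0"
    using assms by (auto simp: independent_insert dest: dependent_zero)
  have "inj ?L"
    unfolding linear_injective_0[OF lin]
  proof safe
    fix \<alpha> \<beta> :: real
    assume eq: "fst (\<alpha>, \<beta>) *\<^sub>R u + snd (\<alpha>, \<beta>) *\<^sub>R w = 0"
    have "\<alpha> = 0"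
    proof (rule ccontr)
      assume "\<alpha> \<noteq> 0"
      have "\<alpha> *\<^sub>R u = (- \<beta>) *\<^sub>R w" using eq by (simp add: eq_neg_iff_add_eq_0)
      then have "u = (- \<beta> / \<alpha>) *\<^sub>R w"
        using \<open>\<alpha> \<noteq> 0\<close> by (metis divide_inverse_commute scaleR_scaleR vector_fraction_eq_iff)
      then have "u \<in> span {w}"
        unfolding span_singleton by blast
      then show False using \<open>u \<notin> span {w}\<close> by blast
    qed
    with eq \<open>w \<noteq> 0\<close> show "(\<alpha>, \<beta>) = 0" by (simp add: zero_prod_def)
  qed
  obtain c where c: "c > 0" "\<And>p. c * norm p \<le> norm (?L p)"
    using linear_inj_bounded_below_pos[OF lin \<open>inj ?L\<close>] by auto
  have le: "\<bar>\<alpha>\<bar> \<le> norm (\<alpha>, \<beta>)" "\<bar>\<beta>\<bar> \<le> norm (\<alpha>, \<beta>)" for \<alpha> \<beta> :: real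
    by (auto simp: norm_Pair real_le_rsqrt)
  show ?thesis
  proof
    show "c * \<bar>\<alpha>\<bar> \<le> norm (\<alpha> *\<^sub>R u + \<beta> *\<^sub>R w)" for \<alpha> \<beta>
      using order_trans[OF mult_left_mono[OF le(1)] c(2)[of "(\<alpha>, \<beta>)"]] c(1) by simp
    show "c * \<bar>\<beta>\<bar> \<le> norm (\<alpha> *\<^sub>R u + \<beta> *\<^sub>R w)" for \<alpha> \<beta>
      using order_trans[OF mult_left_mono[OF le(2)] c(2)[of "(\<alpha>, \<beta>)"]] c(1) by simp
    show "\<exists>\<alpha> \<beta>. x = \<alpha> *\<^sub>R u + \<beta> *\<^sub>R w" for x
    proof -
      have "UNIV \<subseteq> span {u, w}"
        using assms by (intro card_ge_dim_independent) auto
      then have "x \<in> span {u, w}" by blast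
      then obtain \<alpha> \<beta> where "x - \<alpha> *\<^sub>R u = \<beta> *\<^sub>R w"
        by (auto simp: span_breakdown_eq span_singleton)
      then have "x = \<alpha> *\<^sub>R u + \<beta> *\<^sub>R w" by (simp add: algebra_simps)
      then show ?thesis by blast
    qed
  qed (use c in auto)
qed

text \<open>Subtracting the integer parts of the coordinates of one endpoint moves an edge so that
  it meets a fixed ball, and local finiteness leaves only finitely many edges there. Endpoints are
  chosen for each of these, so \<open>P\<close> also fixes an orientation.\<close>

lemma periodic_lattice_fundamental_edges:
  assumes "periodic_lattice V E"
  obtains u w P where "u \<noteq> w" "independent {u, w}" "finite P" "\<And>a b. (a, b) \<in> P \<Longrightarrow> a \<noteq> b"
    "\<And>e. e \<in> E \<Longrightarrow> \<exists>m n :: int. \<exists>(a, b)\<in>P.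
      e = closed_segment (of_int m *\<^sub>R u + of_int n *\<^sub>R w + a) (of_int m *\<^sub>R u + of_int n *\<^sub>R w + b)"
proof -
  obtain u w where uw: "u \<noteq> w" "independent {u, w}"
    and "\<forall>m n :: int. let t = of_int m *\<^sub>R u + of_int n *\<^sub>R w in
      (+) t ` V = V \<and> (\<lambda>e. (+) t ` e) ` E = E"
    using assms unfolding periodic_lattice_def by (elim conjE exE) (rule that)
  then have trans: "(\<lambda>e. (+) (of_int m *\<^sub>R u + of_int n *\<^sub>R w) ` e) ` E = E" for m n :: int
    by (simp add: Let_def)
  have coords: "\<exists>\<alpha> \<beta>. x = \<alpha> *\<^sub>R u + \<beta> *\<^sub>R w" for x
    by (rule independent_pair_coordinates[OF uw]) blast
  define R where "R = norm u + norm w"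
  define E0 where "E0 = {e \<in> E. e \<inter> cball 0 R \<noteq> {}}"
  have "finite E0"
    using assms by (simp add: E0_def periodic_lattice_def locally_finite_graph_def)
  have "\<forall>e\<in>E. \<exists>a\<in>V. \<exists>b\<in>V. a \<noteq> b \<and> e = closed_segment a b \<and> e \<inter> V = {a, b}"
    using assms unfolding periodic_lattice_def planar_straight_graph_def by (elim conjE)
  then have "\<exists>a b. a \<noteq> b \<and> e = closed_segment a b" if "e \<in> E" for e
    using that by meson
  then obtain a b where ab: "\<And>e. e \<in> E \<Longrightarrow> a e \<noteq> b e" "\<And>e. e \<in> E \<Longrightarrow> e = closed_segment (a e) (b e)"
    by metis
  show ?thesis
  proof (rule that[OF uw])
    show "finite ((\<lambda>e. (a e, b e)) ` E0)"
      using \<open>finite E0\<close> by simp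
    show "x \<noteq> y" if "(x, y) \<in> (\<lambda>e. (a e, b e)) ` E0" for x y
      using that ab(1) by (auto simp: E0_def)
    fix e assume e: "e \<in> E"
    obtain \<alpha> \<beta> where \<alpha>\<beta>: "a e = \<alpha> *\<^sub>R u + \<beta> *\<^sub>R w" using coords by blast
    define t where "t = of_int \<lfloor>\<alpha>\<rfloor> *\<^sub>R u + of_int \<lfloor>\<beta>\<rfloor> *\<^sub>R w"
    define e0 where "e0 = (+) (- t) ` e"
    have minus_t: "- t = of_int (- \<lfloor>\<alpha>\<rfloor>) *\<^sub>R u + of_int (- \<lfloor>\<beta>\<rfloor>) *\<^sub>R w"
      by (simp add: t_def)
    have "e0 \<in> (\<lambda>e. (+) (- t) ` e) ` E"
      unfolding e0_def using e by (rule imageI)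
    then have "e0 \<in> E"
      by (simp only: minus_t trans)
    have "a e \<in> e" using ab(2)[OF e] by (metis ends_in_segment(1))
    then have "- t + a e \<in> e0" by (simp add: e0_def)
    moreover have "norm (- t + a e) \<le> R"
    proof -
      have "- t + a e = frac \<alpha> *\<^sub>R u + frac \<beta> *\<^sub>R w"
        by (simp add: t_def \<alpha>\<beta> frac_def algebra_simps)
      also have "norm \<dots> \<le> frac \<alpha> * norm u + frac \<beta> * norm w"
        by (intro order_trans[OF norm_triangle_ineq]) simp
      also have "\<dots> \<le> 1 * norm u + 1 * norm w"
        by (intro add_mono mult_right_mono) (auto intro: less_imp_le frac_lt_1)
      finally show ?thesis by (simp add: R_def)
    qed
    ultimately have "e0 \<in> E0"
      using \<open>e0 \<in> E\<close> by (auto simp: E0_def)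
    moreover have "e = (+) t ` e0"
      by (simp add: e0_def image_image)
    then have "e = closed_segment (t + a e0) (t + b e0)"
      using ab(2)[OF \<open>e0 \<in> E\<close>] by (simp add: closed_segment_translation)
    ultimately show "\<exists>m n :: int. \<exists>(x, y)\<in>(\<lambda>e. (a e, b e)) ` E0.
        e = closed_segment (of_int m *\<^sub>R u + of_int n *\<^sub>R w + x) (of_int m *\<^sub>R u + of_int n *\<^sub>R w + y)"
      unfolding t_def by blast
  qed
qed

lemma card_bounded_ints:
  assumes "X \<ge> 0"
  shows "finite {m :: int. \<bar>real_of_int m\<bar> \<le> X} \<and>
    real (card {m :: int. \<bar>real_of_int m\<bar> \<le> X}) \<le> 2 * X + 1"
proof -
  have "{m :: int. \<bar>real_of_int m\<bar> \<le> X} = {- \<lfloor>X\<rfloor>..\<lfloor>X\<rfloor>}"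
    by (auto simp: abs_le_iff le_floor_iff minus_le_iff)
  then show ?thesis using \<open>X \<ge> 0\<close> by (auto simp: le_nat_iff)
qed

text \<open>The direction set \<open>W\<close> does not depend on s and \<epsilon>, so the constants
  of single directions can be made uniform. As \<open>X\<close> only has to cover the edges in the
  square, it may contain further segments.\<close>

lemma periodic_lattice_scaled_edges:
  assumes "periodic_lattice V E"
  obtains W L where "finite W" "0 \<notin> W" "L \<ge> 0"
    "\<And>s \<epsilon>. 1 \<le> s \<Longrightarrow> 0 < \<epsilon> \<Longrightarrow> \<epsilon> \<le> 1 \<Longrightarrow> \<exists>X. finite X \<and> real (card X) \<le> L * (s / \<epsilon>)\<^sup>2 \<and> X \<subseteq> UNIV \<times> W \<and>
      (\<forall>e\<in>scaled_edges \<epsilon> E. e \<subseteq> square s \<longrightarrow> (\<exists>(x, v)\<in>X. e = closed_segment x (x + \<epsilon> *\<^sub>R v)))"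
proof -
  obtain u w P where uw: "u \<noteq> w" "independent {u, w}" and P: "finite P" "\<And>a b. (a, b) \<in> P \<Longrightarrow> a \<noteq> b"
    and E: "\<And>e. e \<in> E \<Longrightarrow> \<exists>m n :: int. \<exists>(a, b)\<in>P.
      e = closed_segment (of_int m *\<^sub>R u + of_int n *\<^sub>R w + a) (of_int m *\<^sub>R u + of_int n *\<^sub>R w + b)"
    using periodic_lattice_fundamental_edges[OF assms] by metis
  obtain c where "c > 0" and c: "\<And>\<alpha> \<beta>. c * \<bar>\<alpha>\<bar> \<le> norm (\<alpha> *\<^sub>R u + \<beta> *\<^sub>R w)"
    "\<And>\<alpha> \<beta>. c * \<bar>\<beta>\<bar> \<le> norm (\<alpha> *\<^sub>R u + \<beta> *\<^sub>R w)"
    using independent_pair_coordinates[OF uw] by metis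
  define R where "R = (\<Sum>p\<in>P. norm (fst p))"
  have R: "norm a \<le> R" if "(a, b) \<in> P" for a b
    using member_le_sum[OF that, of "\<lambda>p. norm (fst p)"] P(1) by (simp add: R_def)
  have "R \<ge> 0" by (simp add: R_def sum_nonneg)
  \<comment> \<open>If an edge t + [a, b] scales into the square, then |t| <= 2 s/\<epsilon> + R <=
    (2 + R) s/\<epsilon>, because s/\<epsilon> >= 1; division by c bounds the integer coordinates of
    t.\<close>
  define B where "B = (2 + R) / c"
  have "B \<ge> 0" using \<open>R \<ge> 0\<close> \<open>c > 0\<close> by (simp add: B_def)
  define W where "W = (\<lambda>(a, b). b - a) ` P"
  define L where "L = real (card P) * (2 * B + 1)\<^sup>2"
  show ?thesis
  proof
    show "finite W" using P(1) by (simp add: W_def)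
    show "0 \<notin> W" using P(2) by (force simp: W_def)
    show "L \<ge> 0" by (simp add: L_def)
    fix s \<epsilon> :: real
    assume s: "1 \<le> s" and \<epsilon>: "0 < \<epsilon>" "\<epsilon> \<le> 1"
    have r: "s / \<epsilon> \<ge> 1" using s \<epsilon> by simp
    define I where "I = {m :: int. \<bar>real_of_int m\<bar> \<le> B * (s / \<epsilon>)}"
    have I: "finite I" "real (card I) \<le> (2 * B + 1) * (s / \<epsilon>)"
    proof -
      have "B * (s / \<epsilon>) \<ge> 0" using \<open>B \<ge> 0\<close> r by (intro mult_nonneg_nonneg) auto
      note * = card_bounded_ints[OF this]
      then show "finite I" by (simp add: I_def)
      have "real (card I) \<le> 2 * (B * (s / \<epsilon>)) + 1" using * by (simp add: I_def)
      also have "\<dots> \<le> (2 * B + 1) * (s / \<epsilon>)" using r by (simp add: algebra_simps)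
      finally show "real (card I) \<le> (2 * B + 1) * (s / \<epsilon>)" .
    qed
    define F where "F = (\<lambda>((a, b), m, n). (\<epsilon> *\<^sub>R (of_int m *\<^sub>R u + of_int n *\<^sub>R w + a), b - a :: real^2))"
    define X where "X = F ` (P \<times> I \<times> I)"
    show "\<exists>X. finite X \<and> real (card X) \<le> L * (s / \<epsilon>)\<^sup>2 \<and> X \<subseteq> UNIV \<times> W \<and>
      (\<forall>e\<in>scaled_edges \<epsilon> E. e \<subseteq> square s \<longrightarrow> (\<exists>(x, v)\<in>X. e = closed_segment x (x + \<epsilon> *\<^sub>R v)))"
    proof (intro exI[of _ X] conjI ballI impI)
      show "finite X" using P(1) I(1) by (simp add: X_def)
      have "card X \<le> card P * (card I * card I)"
        unfolding X_def using card_image_le[of "P \<times> I \<times> I" F] P(1) I(1) by (simp add: card_cartesian_product)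
      then have "real (card X) \<le> real (card P) * (real (card I) * real (card I))"
        by (metis of_nat_mono of_nat_mult)
      also have "\<dots> \<le> real (card P) * (((2 * B + 1) * (s / \<epsilon>)) * ((2 * B + 1) * (s / \<epsilon>)))"
        using I(2) \<open>B \<ge> 0\<close> r by (intro mult_left_mono mult_mono) auto
      also have "\<dots> = L * (s / \<epsilon>)\<^sup>2"
        by (simp add: L_def power2_eq_square)
      finally show "real (card X) \<le> L * (s / \<epsilon>)\<^sup>2" .
      show "X \<subseteq> UNIV \<times> W"
        by (auto simp: X_def F_def W_def intro!: image_eqI)
      fix e assume "e \<in> scaled_edges \<epsilon> E" and sq: "e \<subseteq> square s"
      then obtain e' where "e' \<in> E" and e: "e = (*\<^sub>R) \<epsilon> ` e'"
        by (auto simp: scaled_edges_def)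
      then obtain m n :: int and a b where ab: "(a, b) \<in> P"
        and e': "e' = closed_segment (of_int m *\<^sub>R u + of_int n *\<^sub>R w + a) (of_int m *\<^sub>R u + of_int n *\<^sub>R w + b)"
        using E by blast
      define t where "t = of_int m *\<^sub>R u + of_int n *\<^sub>R w"
      have "e = closed_segment (\<epsilon> *\<^sub>R (t + a)) (\<epsilon> *\<^sub>R (t + b))"
        unfolding e e' t_def[symmetric]
        by (intro closed_segment_linear_image[symmetric]) simp
      also have "\<epsilon> *\<^sub>R (t + b) = \<epsilon> *\<^sub>R (t + a) + \<epsilon> *\<^sub>R (b - a)"
        by (simp add: algebra_simps)
      finally have e_eq: "e = closed_segment (\<epsilon> *\<^sub>R (t + a)) (\<epsilon> *\<^sub>R (t + a) + \<epsilon> *\<^sub>R (b - a))" .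
      then have "\<epsilon> *\<^sub>R (t + a) \<in> square s"
        using sq by (metis ends_in_segment(1) subsetD)
      then have "\<epsilon> * norm (t + a) \<le> 2 * s"
        using norm_le_of_mem_square[of "\<epsilon> *\<^sub>R (t + a)" s] \<epsilon> by simp
      then have "norm (t + a) \<le> 2 * (s / \<epsilon>)"
        using \<epsilon> by (simp add: field_simps)
      moreover have "norm t \<le> norm (t + a) + norm a"
        using norm_triangle_ineq4[of "t + a" a] by simp
      moreover have "R \<le> R * (s / \<epsilon>)"
        using mult_left_mono[OF r \<open>R \<ge> 0\<close>] by simp
      ultimately have t: "norm t \<le> (2 + R) * (s / \<epsilon>)"
        using R[OF ab] by (simp add: algebra_simps)
      have "c * \<bar>real_of_int m\<bar> \<le> (2 + R) * (s / \<epsilon>)" "c * \<bar>real_of_int n\<bar> \<le> (2 + R) * (s / \<epsilon>)"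
        using order_trans[OF c(1) t[unfolded t_def]] order_trans[OF c(2) t[unfolded t_def]] .
      then have "\<bar>real_of_int m\<bar> \<le> (2 + R) * (s / \<epsilon>) / c" "\<bar>real_of_int n\<bar> \<le> (2 + R) * (s / \<epsilon>) / c"
        using \<open>c > 0\<close> by (simp_all only: pos_le_divide_eq mult.commute[of c])
      then have "m \<in> I" "n \<in> I"
        by (simp_all add: I_def B_def mult.commute)
      then have "F ((a, b), m, n) \<in> X"
        using ab by (auto simp: X_def)
      then show "\<exists>(x, v)\<in>X. e = closed_segment x (x + \<epsilon> *\<^sub>R v)"
        using e_eq by (intro bexI[of _ "F ((a, b), m, n)"]) (auto simp: F_def t_def)
    qed
  qed
qed

lemma class_C_imp_continuous: "class_C k g \<Longrightarrow> continuous_on UNIV g"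
  by (induction k) (metis class_C.simps(1), metis class_C_Suc_imp)

section \<open>Union bound over the edges, and measurability\<close>

context smooth_gaussian_field
begin

lemma finite_directions_two_zeros_bound:
  assumes "finite W" "0 \<notin> W"
  shows "\<exists>C\<ge>0. \<exists>q\<^sub>0>0. \<forall>v\<in>W. \<forall>x q. 0 < q \<and> q < q\<^sub>0 \<longrightarrow> (\<exists>B\<in>events. prob B \<le> C * q ^ 10 \<and>
    (\<forall>\<omega>\<in>space M. \<forall>z1 z2. class_C 2 (f \<omega>) \<and> 0 \<le> z1 \<and> z1 < z2 \<and> z2 \<le> q ^ 4 \<and>
       f \<omega> (x + z1 *\<^sub>R v) = 0 \<and> f \<omega> (x + z2 *\<^sub>R v) = 0 \<longrightarrow> \<omega> \<in> B))"
  (is "\<exists>C\<ge>0. \<exists>q\<^sub>0>0. \<forall>v\<in>W. \<forall>x q. _ \<longrightarrow> ?P C v x q")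
  using assms
proof (induction W)
  case empty
  show ?case by (auto intro: exI[of _ 0] exI[of _ 1])
next
  case (insert v W)
  then obtain C q0 where "C \<ge> 0" "q0 > 0" and W: "\<And>v x q. v \<in> W \<Longrightarrow> 0 < q \<Longrightarrow> q < q0 \<Longrightarrow> ?P C v x q"
    by auto
  have "v \<noteq> 0" using insert.prems by auto
  then obtain C' q0' where "C' \<ge> 0" "q0' > 0" and v: "\<And>x q. 0 < q \<Longrightarrow> q < q0' \<Longrightarrow> ?P C' v x q"
    using segment_two_zeros_bound[of v] by auto
  have mono: "?P C1 y x q \<Longrightarrow> C1 \<le> C2 \<Longrightarrow> 0 < q \<Longrightarrow> ?P C2 y x q" for C1 C2 y x q
    by (meson order_trans mult_right_mono zero_le_power less_imp_le)
  have "\<forall>y\<in>insert v W. \<forall>x q. 0 < q \<and> q < min q0 q0' \<longrightarrow> ?P (max C C') y x q"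
  proof (intro ballI allI impI)
    fix y x q assume y: "y \<in> insert v W" and q: "0 < q \<and> q < min q0 q0'"
    show "?P (max C C') y x q"
    proof (cases "y = v")
      case True
      have "?P C' v x q" using v q by simp
      then show ?thesis unfolding True by (rule mono) (use q in auto)
    next
      case False
      have "?P C y x q" using W False y q by simp
      then show ?thesis by (rule mono) (use q in auto)
    qed
  qed
  moreover have "max C C' \<ge> 0" "min q0 q0' > 0"
    using \<open>C \<ge> 0\<close> \<open>q0 > 0\<close> \<open>q0' > 0\<close> by auto
  ultimately show ?case
    by - (rule exI[of _ "max C C'"], rule conjI, assumption, rule exI[of _ "min q0 q0'"], rule conjI)
qed

end

text \<open>Nothing is known about the paths on the exceptional null set, so the event may fail to
  be measurable for \<open>M\<close>. Off that set it is given by countably many values of the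
  field. The probability comes from the union bound over the supersets \<open>B\<close>.\<close>

lemma (in prob_space) crosses_at_most_once_completion:
  fixes f :: "'a \<Rightarrow> real^2 \<Rightarrow> real"
  assumes "smooth_gaussian_field M f K"
    and "finite X" "\<epsilon> > 0" "0 \<notin> snd ` X"
    and X: "\<forall>e\<in>E. e \<subseteq> square s \<longrightarrow> (\<exists>(x, v)\<in>X. e = closed_segment x (x + \<epsilon> *\<^sub>R v))"
    and bad: "\<forall>p\<in>X. \<exists>B\<in>events. prob B \<le> b \<and>
      (\<forall>\<omega>\<in>space M. \<forall>z1 z2. class_C 2 (f \<omega>) \<and> 0 \<le> z1 \<and> z1 < z2 \<and> z2 \<le> \<epsilon> \<and>
         f \<omega> (fst p + z1 *\<^sub>R snd p) = 0 \<and> f \<omega> (fst p + z2 *\<^sub>R snd p) = 0 \<longrightarrow> \<omega> \<in> B)"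
  defines "A \<equiv> {\<omega> \<in> space M. crosses_edges_at_most_once (f \<omega>) E s}"
  shows "A \<in> sets (completion M)" and "measure (completion M) A \<ge> 1 - real (card X) * b"
proof -
  interpret smooth_gaussian_field M f K by fact
  from bchoice[OF bad[unfolded Bex_def]] obtain B where "\<forall>p\<in>X. B p \<in> events \<and> prob (B p) \<le> b \<and>
      (\<forall>\<omega>\<in>space M. \<forall>z1 z2. class_C 2 (f \<omega>) \<and> 0 \<le> z1 \<and> z1 < z2 \<and> z2 \<le> \<epsilon> \<and>
         f \<omega> (fst p + z1 *\<^sub>R snd p) = 0 \<and> f \<omega> (fst p + z2 *\<^sub>R snd p) = 0 \<longrightarrow> \<omega> \<in> B p)"
    ..
  note B_all = bspec[OF this]
  have B: "B p \<in> events" "prob (B p) \<le> b" if "p \<in> X" for p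
    using B_all[OF that] by simp_all
  have two: "\<omega> \<in> B (x, v)"
    if "(x, v) \<in> X" "\<omega> \<in> space M" "class_C 2 (f \<omega>)" "0 \<le> z1" "z1 < z2" "z2 \<le> \<epsilon>"
      "f \<omega> (x + z1 *\<^sub>R v) = 0" "f \<omega> (x + z2 *\<^sub>R v) = 0" for x v \<omega> z1 z2
    using conjunct2[OF conjunct2[OF B_all[OF that(1)]], rule_format, of \<omega> z1 z2] that by simp
  obtain N where N: "\<And>\<omega>. \<omega> \<in> space M - N \<Longrightarrow> class_C 2 (f \<omega>)" "N \<in> null_sets M"
    using AE_E3[OF class_C_2] by metis
  then have [measurable]: "N \<in> events" by auto
  \<comment> \<open>\<open>X\<close> may contain segments that are not edges in the square. They do
    no harm to the union bound, but the exact description of the event needed for measurability must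
    exclude them.\<close>
  define X' where "X' = {(x, v) \<in> X. closed_segment x (x + \<epsilon> *\<^sub>R v) \<in> E \<and> closed_segment x (x + \<epsilon> *\<^sub>R v) \<subseteq> square s}"
  have X': "X' \<subseteq> X" "finite X'"
    using \<open>finite X\<close> by (auto simp: X'_def intro: finite_subset)
  define T where "T \<omega> = (\<lambda>(x, v). \<exists>p\<in>\<rat>. \<exists>q\<in>\<rat>. 0 < p \<and> p < q \<and> q < \<epsilon> \<and>
      (\<forall>n. \<exists>t\<in>{0..p} \<inter> \<rat>. \<bar>f \<omega> (x + t *\<^sub>R v)\<bar> < inverse (real (Suc n))) \<and>
      (\<forall>n. \<exists>t\<in>{q..\<epsilon>} \<inter> \<rat>. \<bar>f \<omega> (x + t *\<^sub>R v)\<bar> < inverse (real (Suc n))))" for \<omega>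
  define S where "S = {\<omega> \<in> space M. \<forall>p\<in>X'. \<not> T \<omega> p} - N"
  have T_iff: "T \<omega> (x, v) \<longleftrightarrow> (\<exists>z1 z2. 0 \<le> z1 \<and> z1 < z2 \<and> z2 \<le> \<epsilon> \<and>
      f \<omega> (x + z1 *\<^sub>R v) = 0 \<and> f \<omega> (x + z2 *\<^sub>R v) = 0)" if "class_C 2 (f \<omega>)" for \<omega> x v
  proof -
    have "continuous_on UNIV (\<lambda>t. f \<omega> (x + t *\<^sub>R v))"
      by (intro continuous_on_compose2[OF class_C_imp_continuous[OF that]] continuous_intros) auto
    from two_zeros_iff_rational[OF this, of \<epsilon>] show ?thesis
      by (simp only: T_def split_conv)
  qed
  have "crosses_edges_at_most_once (f \<omega>) E s \<longleftrightarrow> (\<forall>p\<in>X'. \<not> T \<omega> p)" if "class_C 2 (f \<omega>)" for \<omega>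
  proof -
    let ?ok = "\<lambda>e. finite (e \<inter> f \<omega> -` {0}) \<and> card (e \<inter> f \<omega> -` {0}) \<le> 1"
    have "?ok (closed_segment x (x + \<epsilon> *\<^sub>R v)) \<longleftrightarrow> \<not> T \<omega> (x, v)" if "(x, v) \<in> X" for x v
    proof -
      have "v \<noteq> 0" using that \<open>0 \<notin> snd ` X\<close> by force
      from segment_zeros_le_1_iff[OF \<open>\<epsilon> > 0\<close> this] show ?thesis
        by (simp only: T_iff[OF \<open>class_C 2 (f \<omega>)\<close>])
    qed
    then have "(\<forall>(x, v)\<in>X'. ?ok (closed_segment x (x + \<epsilon> *\<^sub>R v))) \<longleftrightarrow> (\<forall>p\<in>X'. \<not> T \<omega> p)"
      by (intro ball_cong refl) (use X'(1) in auto)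
    moreover have "crosses_edges_at_most_once (f \<omega>) E s \<longleftrightarrow> (\<forall>(x, v)\<in>X'. ?ok (closed_segment x (x + \<epsilon> *\<^sub>R v)))"
      unfolding crosses_edges_at_most_once_def X'_def using X by fastforce
    ultimately show ?thesis by simp
  qed
  then have A_eq: "A = S \<union> (A \<inter> N)"
    using N(1) by (auto simp: A_def S_def)
  have Rats: "countable (I \<inter> \<rat>)" for I :: "real set"
    using countable_rat by (rule countable_subset[rotated]) auto
  have T_meas: "{\<omega> \<in> space M. T \<omega> p} \<in> events" for p
    unfolding T_def case_prod_unfold
    by (intro sets.sets_Collect_countable_Ex' sets.sets_Collect_conj sets.sets_Collect_countable_All
        countable_rat Rats sets.sets_Collect_const) measurable
  have "{\<omega> \<in> space M. \<forall>p\<in>X'. \<not> T \<omega> p} \<in> events"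
    by (intro sets.sets_Collect_finite_All sets.sets_Collect_neg T_meas X')
  then have S: "S \<in> events"
    unfolding S_def by auto
  show A: "A \<in> sets (completion M)"
    by (rule sets_completionI[OF A_eq _ N(2) S]) auto
  have U: "(\<Union>p\<in>X. B p) \<union> N \<in> events"
    using B(1) \<open>finite X\<close> by (intro sets.Un sets.finite_UN) auto
  have "space M - ((\<Union>p\<in>X. B p) \<union> N) \<subseteq> S"
    using X'(1) two N(1) by (fastforce simp: S_def T_iff)
  then have "prob (space M - ((\<Union>p\<in>X. B p) \<union> N)) \<le> prob S"
    by (rule finite_measure_mono[OF _ S])
  moreover have "prob (space M - ((\<Union>p\<in>X. B p) \<union> N)) = 1 - prob ((\<Union>p\<in>X. B p) \<union> N)"
    using U by (rule prob_compl)
  moreover have "prob ((\<Union>p\<in>X. B p) \<union> N) \<le> real (card X) * b"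
  proof -
    have "prob ((\<Union>p\<in>X. B p) \<union> N) \<le> prob (\<Union>p\<in>X. B p) + prob N"
      using B(1) \<open>finite X\<close> by (intro measure_Un_le sets.finite_UN) auto
    also have "prob N = 0"
      using N(2) by (simp add: measure_def null_setsD1)
    also have "prob (\<Union>p\<in>X. B p) \<le> (\<Sum>p\<in>X. prob (B p))"
      using B(1) \<open>finite X\<close> by (intro measure_UNION_le)
    also have "\<dots> \<le> real (card X) * b"
      using sum_bounded_above[of X "\<lambda>p. prob (B p)" b] B(2) by simp
    finally show ?thesis by simp
  qed
  ultimately have "1 - real (card X) * b \<le> prob S" by linarith
  also have "prob S = measure (completion M) S"
    using S by simp
  also have "\<dots> \<le> measure (completion M) A"
  proof -
    interpret completion: prob_space "completion M"
      by (rule prob_space_completion)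
    show ?thesis
      using A A_eq by (intro completion.finite_measure_mono) auto
  qed
  finally show "measure (completion M) A \<ge> 1 - real (card X) * b" .
qed

theorem theorem1p5:
  fixes M :: "'w measure"
    and f :: "'w \<Rightarrow> real^2 \<Rightarrow> real"
    and K :: "real^2 \<Rightarrow> real"
    and V :: "(real^2) set" and E :: "(real^2) set set"
    and \<delta> \<eta> :: real
  assumes "prob_space M"
    and "gaussian_field M f" and "centered_field M f" and "stationary_field M f"
    and "AE \<omega> in M. class_C 3 (f \<omega>)"
    and "has_covariance M f K" and "K 0 = 1"
    and "\<forall>k\<in>{0..3}. nondegenerate_at_order k K"
    and "periodic_lattice V E"
    and "\<delta> > 0" and "\<eta> > 0"
  shows "\<exists>s\<^sub>0>0. \<forall>s\<ge>s\<^sub>0. \<forall>\<epsilon>. 0 < \<epsilon> \<and> \<epsilon> \<le> s powr (- 8 - \<eta>) \<longrightarrow>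
    (let A = {\<omega> \<in> space M. crosses_edges_at_most_once (f \<omega>) (scaled_edges \<epsilon> E) s}
     in A \<in> sets (completion M) \<and> measure (completion M) A \<ge> 1 - \<delta>)"
proof -
  interpret prob_space M by fact
  have "class_C 2 g" if "class_C 3 g" for g :: "real^2 \<Rightarrow> real"
    using that class_C_Suc_imp[of 2 g] by (simp add: eval_nat_numeral)
  then have "AE \<omega> in M. class_C 2 (f \<omega>)"
    using assms(5) by (auto elim: eventually_mono)
  moreover have "nondegenerate_at_order 1 K"
    using assms(8) by auto
  ultimately interpret smooth_gaussian_field M f K
    using assms by unfold_locales auto
  obtain W L where W: "finite W" "0 \<notin> W" and "L \<ge> 0"
    and edges: "\<And>s \<epsilon>. 1 \<le> s \<Longrightarrow> 0 < \<epsilon> \<Longrightarrow> \<epsilon> \<le> 1 \<Longrightarrow>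
      \<exists>X. finite X \<and> real (card X) \<le> L * (s / \<epsilon>)\<^sup>2 \<and> X \<subseteq> UNIV \<times> W \<and>
      (\<forall>e\<in>scaled_edges \<epsilon> E. e \<subseteq> square s \<longrightarrow> (\<exists>(x, v)\<in>X. e = closed_segment x (x + \<epsilon> *\<^sub>R v)))"
    by (rule periodic_lattice_scaled_edges[OF assms(9)]) blast
  obtain C q0 where "C \<ge> 0" "q0 > 0" and bad: "\<And>v x q. v \<in> W \<Longrightarrow> 0 < q \<Longrightarrow> q < q0 \<Longrightarrow>
    \<exists>B\<in>events. prob B \<le> C * q ^ 10 \<and>
      (\<forall>\<omega>\<in>space M. \<forall>z1 z2. class_C 2 (f \<omega>) \<and> 0 \<le> z1 \<and> z1 < z2 \<and> z2 \<le> q ^ 4 \<and>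
         f \<omega> (x + z1 *\<^sub>R v) = 0 \<and> f \<omega> (x + z2 *\<^sub>R v) = 0 \<longrightarrow> \<omega> \<in> B)"
    using finite_directions_two_zeros_bound[OF W] by auto
  \<comment> \<open>The summands ensure s >= 1, then 1 / s < q0 and hence q < q0, and finally L C /
    s <= \<delta>.\<close>
  define s0 where "s0 = 1 + 1 / q0 + L * C / \<delta>"
  have "s0 > 0" "s0 \<ge> 1"
    using \<open>q0 > 0\<close> \<open>L \<ge> 0\<close> \<open>C \<ge> 0\<close> \<open>\<delta> > 0\<close> by (auto simp: s0_def intro!: add_pos_nonneg add_nonneg_nonneg)
  show ?thesis
  proof (intro exI[of _ s0] conjI allI impI)
    fix s \<epsilon> :: real
    assume s: "s0 \<le> s" and \<epsilon>: "0 < \<epsilon> \<and> \<epsilon> \<le> s powr (- 8 - \<eta>)"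
    have "s \<ge> 1" using s \<open>s0 \<ge> 1\<close> by linarith
    define q where "q = root 4 \<epsilon>"
    have q: "q > 0" "q ^ 4 = \<epsilon>" using \<epsilon> by (auto simp: q_def)
    \<comment> \<open>The origin of the exponent 8: the union bound is controlled by s q, which is
      at most 1 / s once q <= s^(-2).\<close>
    have "q ^ 4 \<le> s powr (- 8)"
      using \<epsilon> q \<open>s \<ge> 1\<close> \<open>\<eta> > 0\<close> powr_mono[of "- 8 - \<eta>" "- 8" s] by auto
    also have "\<dots> = (1 / s\<^sup>2) ^ 4"
      using \<open>s \<ge> 1\<close> by (simp add: powr_minus_divide power_divide power_mult[symmetric])
    finally have q_le: "q \<le> 1 / s\<^sup>2"
      by (rule power_le_imp_le_base[of q 3, simplified]) (use \<open>s \<ge> 1\<close> in auto)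
    have "1 / s\<^sup>2 \<le> 1 / s"
      using \<open>s \<ge> 1\<close> by (simp add: field_simps power2_eq_square)
    have "1 / q0 < s"
    proof -
      have "L * C / \<delta> \<ge> 0" using \<open>L \<ge> 0\<close> \<open>C \<ge> 0\<close> \<open>\<delta> > 0\<close> by simp
      then show ?thesis using s by (simp add: s0_def)
    qed
    then have "1 / s < q0"
      using \<open>q0 > 0\<close> \<open>s \<ge> 1\<close> by (simp add: field_simps)
    then have "q < q0" using q_le \<open>1 / s\<^sup>2 \<le> 1 / s\<close> by linarith
    have "q \<le> 1"
      using q_le \<open>1 / s\<^sup>2 \<le> 1 / s\<close> \<open>s \<ge> 1\<close> by (simp add: order_trans divide_le_eq_1)
    then have "\<epsilon> \<le> 1" using q by (metis less_imp_le power_le_one)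
    then obtain X where X: "finite X" "real (card X) \<le> L * (s / \<epsilon>)\<^sup>2" "X \<subseteq> UNIV \<times> W"
      "\<forall>e\<in>scaled_edges \<epsilon> E. e \<subseteq> square s \<longrightarrow> (\<exists>(x, v)\<in>X. e = closed_segment x (x + \<epsilon> *\<^sub>R v))"
      using edges[OF \<open>s \<ge> 1\<close> conjunct1[OF \<epsilon>] \<open>\<epsilon> \<le> 1\<close>] by (elim exE conjE) (rule that)
    have bad_X: "\<forall>p\<in>X. \<exists>B\<in>events. prob B \<le> C * q ^ 10 \<and>
      (\<forall>\<omega>\<in>space M. \<forall>z1 z2. class_C 2 (f \<omega>) \<and> 0 \<le> z1 \<and> z1 < z2 \<and> z2 \<le> q ^ 4 \<and>
         f \<omega> (fst p + z1 *\<^sub>R snd p) = 0 \<and> f \<omega> (fst p + z2 *\<^sub>R snd p) = 0 \<longrightarrow> \<omega> \<in> B)"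
      using \<open>q > 0\<close> \<open>q < q0\<close> X(3) by (intro ballI bad) auto
    have "0 \<notin> snd ` X" using X(3) W(2) by auto
    note completion = crosses_at_most_once_completion[OF smooth_gaussian_field_axioms X(1)
        conjunct1[OF \<epsilon>] this X(4) bad_X[unfolded q(2)]]
    have "real (card X) * (C * q ^ 10) \<le> L * (s / \<epsilon>)\<^sup>2 * (C * q ^ 10)"
      using X(2) \<open>C \<ge> 0\<close> q by (intro mult_right_mono) auto
    \<comment> \<open>The edges contribute (s / q^4)^2 and each costs q^10, so two powers of q
      survive.\<close>
    also have "\<dots> = L * C * (s * q)\<^sup>2"
      unfolding q(2)[symmetric] using q(1)
      by (simp add: power_divide power_mult_distrib power_mult[symmetric] power_add[symmetric] field_simps)
    also have "\<dots> \<le> L * C * (1 / s)\<^sup>2"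
    proof -
      have "s * q \<le> s * (1 / s\<^sup>2)" using q_le \<open>s \<ge> 1\<close> by (intro mult_left_mono) auto
      also have "\<dots> = 1 / s" using \<open>s \<ge> 1\<close> by (simp add: power2_eq_square)
      finally show ?thesis
        using \<open>L \<ge> 0\<close> \<open>C \<ge> 0\<close> \<open>s \<ge> 1\<close> q by (intro mult_left_mono power_mono) auto
    qed
    also have "\<dots> \<le> L * C * (1 / s)"
    proof -
      have "(1 / s)\<^sup>2 \<le> 1 / s" using \<open>1 / s\<^sup>2 \<le> 1 / s\<close> by (simp add: power_divide)
      then show ?thesis using \<open>L \<ge> 0\<close> \<open>C \<ge> 0\<close> by (intro mult_left_mono) auto
    qed
    also have "\<dots> \<le> \<delta>"
    proof -
      have "L * C / \<delta> \<le> s" using s \<open>q0 > 0\<close> by (simp add: s0_def) (smt (verit) divide_pos_pos)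
      then show ?thesis using \<open>\<delta> > 0\<close> \<open>s \<ge> 1\<close> by (simp add: field_simps)
    qed
    finally have "real (card X) * (C * q ^ 10) \<le> \<delta>" .
    then show "let A = {\<omega> \<in> space M. crosses_edges_at_most_once (f \<omega>) (scaled_edges \<epsilon> E) s}
      in A \<in> sets (completion M) \<and> measure (completion M) A \<ge> 1 - \<delta>"
      using completion by (auto simp: Let_def)
  qed (rule \<open>s0 > 0\<close>)
qed

end
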